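(* Let $\sigma,\omega\in\mathcal{W}$ with $\omega(t)=O(\sigma(t))$ as $t\to\infty$ (so that $\gamma(\sigma,\omega)\ge\gamma(\omega)>0$), and let $0<\gamma<\gamma(\sigma,\omega)$. Let $\Sigma=\{S^x:x>0\}$ and $\Omega=\{W^x:x>0\}$ be the weight matrices associated with $\sigma$ and $\omega$ respectively, and put $\widehat{S}^x:=(p!S^x_p)_{p\in\mathbb{N}}$, $\widehat{W}^x:=(p!W^x_p)_{p\in\mathbb{N}}$. Let $\tau_1:=\omega_{\widehat{S}^{x_1}}$ and $\tau_2:=\omega_{\widehat{W}^{x_2}}$ for some $x_1,x_2>0$. Then for every $l>0$ there exists $l_1>0$ such that there exists a linear and continuous map $$E^{\tau_1,\tau_2}_l:\ \Lambda_{\tau_1,l}\to\mathcal{A}_{\tau_2,l_1}(S_\gamma),\qquad\lambda\mapsto f_\lambda,$$ with $\mathcal{B}(f_\lambda)=\lambda$ for all $\lambda\in\Lambda_{\tau_1,l}$. Thus $\mathcal{B}(\mathcal{A}_{\{\tau_2\}}(S_\gamma))\supseteq\Lambda_{\{\tau_1\}}$.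
   Context: $\mathbb{N}=\{0,1,2,\dots\}$. A weight function is a continuous nondecreasing $\omega:[0,\infty)\to[0,\infty)$ with $\omega(0)=0$ and $\lim_{t\to\infty}\omega(t)=+\infty$; it is normalized if $\omega(t)=0$ for all $t\in[0,1]$. With $\varphi_\omega(t):=\omega(e^t)$, the class $\mathcal{W}$ consists of all normalized weight functions $\omega$ such that $\log(t)=o(\omega(t))$ as $t\to\infty$, $\varphi_\omega$ is convex on $\mathbb{R}$, and $\omega(2t)=O(\omega(t))$ as $t\to\infty$. Growth indices: for weight functions $\sigma,\omega$ with $\omega(t)=O(\sigma(t))$ and $r>0$, condition $(\sigma,\omega)_{\gamma_r}$ means: there is $C>0$ with $\int_1^\infty\frac{\omega(tu)}{u^{1+1/r}}\,du\le C\sigma(t)+C$ for all $t\ge0$; $\gamma(\sigma,\omega):=\sup\{r>0:(\sigma,\omega)_{\gamma_r}\text{ holds}\}\in[0,+\infty]$ ($0$ if there is no such $r$), and $\gamma(\omega):=\gamma(\omega,\omega)$. Associated weight matrix: $\varphi^*_\omega(x):=\sup\{xy-\varphi_\omega(y):y\ge0\}$ for $x\ge0$, and $W^l_j:=\exp\left(\frac1l\varphi^*_\omega(lj)\right)$ for $l>0$, $j\in\mathbb{N}$; $\Sigma=\{S^l\}$ is defined in the same way from $\sigma$. For a sequence $M$ of positive reals with $M_0=1$: $\omega_M(t):=\sup_{p\in\mathbb{N}}\log\left(\frac{t^p}{M_p}\right)$ for $t>0$, $\omega_M(0):=0$. (For $\sigma,\omega\in\mathcal{W}$ it is known that $\omega_{\widehat{S}^x},\omega_{\widehat{W}^x}\in\mathcal{W}$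 and that the function and sequence spaces defined by $\omega_{\widehat{W}^x}$ do not depend on $x>0$, and coincide with those defined by the family $\{\widehat{W}^x:x>0\}$; likewise for $\widehat{S}^x$.) Let $\mathcal{R}$ be the Riemann surface of the logarithm and $S_\gamma:=\{z\in\mathcal{R}:|\arg(z)|<\gamma\pi/2\}$. For a normalized weight function $\tau$ with $\log(t)=o(\tau(t))$, $l>0$ and a sector $S$, $\mathcal{A}_{\tau,l}(S)$ is the Banach space of holomorphic $f$ on $S$ with $\|f\|_{\tau,l}:=\sup_{z\in S,p\in\mathbb{N}}\frac{|f^{(p)}(z)|}{\exp(\frac1l\varphi^*_\tau(lp))}<\infty$, and $\Lambda_{\tau,l}$ is the Banach space of complex sequences $a$ with $|a|_{\tau,l}:=\sup_{p\in\mathbb{N}}\frac{|a_p|}{\exp(\frac1l\varphi^*_\tau(lp))}<\infty$; $\mathcal{A}_{\{\tau\}}(S):=\bigcup_{l>0}\mathcal{A}_{\tau,l}(S)$ and $\Lambda_{\{\tau\}}:=\bigcup_{l>0}\Lambda_{\tau,l}$. The Borel map is $\mathcal{B}(f):=(f^{(p)}(0))_{p\in\mathbb{N}}$ with $f^{(p)}(0):=\lim_{z\in S,\,z\to0}f^{(p)}(z)$. *)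

theory Defs
  imports "HOL-Analysis.Analysis" "HOL-Library.Landau_Symbols"
begin

text \<open>Only the values of a weight function on $[0,\infty)$ matter.\<close>

definition weight_function :: "(real \<Rightarrow> real) \<Rightarrow> bool" where
  "weight_function \<omega> \<longleftrightarrow>
     continuous_on {0..} \<omega> \<and> mono_on {0..} \<omega> \<and> (\<forall>t\<ge>0. \<omega> t \<ge> 0) \<and>
     \<omega> 0 = 0 \<and> filterlim \<omega> at_top at_top"

definition normalized :: "(real \<Rightarrow> real) \<Rightarrow> bool" where
  "normalized \<omega> \<longleftrightarrow> (\<forall>t\<in>{0..1}. \<omega> t = 0)"

definition phi :: "(real \<Rightarrow> real) \<Rightarrow> real \<Rightarrow> real" where
  "phi \<omega> t = \<omega> (exp t)"

definition class_W :: "(real \<Rightarrow> real) set" where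
  "class_W = {\<omega>. weight_function \<omega> \<and> normalized \<omega> \<and> ln \<in> o[at_top](\<omega>) \<and>
     convex_on UNIV (phi \<omega>) \<and> (\<lambda>t. \<omega> (2 * t)) \<in> O[at_top](\<omega>)}"

text \<open>The integral is taken in $[0,\infty]$, so the inequality includes its convergence.\<close>

definition gamma_condition :: "(real \<Rightarrow> real) \<Rightarrow> (real \<Rightarrow> real) \<Rightarrow> real \<Rightarrow> bool" where
  "gamma_condition \<sigma> \<omega> r \<longleftrightarrow>
     (\<exists>C>0. \<forall>t\<ge>0.
        (\<integral>\<^sup>+u\<in>{1..}. ennreal (\<omega> (t * u) / u powr (1 + 1 / r)) \<partial>lborel)
          \<le> ennreal (C * \<sigma> t + C))"

text \<open>In \<^typ>\<open>ennreal\<close> the supremum of the empty set is \<open>0\<close>.\<close>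

definition growth_index :: "(real \<Rightarrow> real) \<Rightarrow> (real \<Rightarrow> real) \<Rightarrow> ennreal" where
  "growth_index \<sigma> \<omega> = (SUP r\<in>{r. r > 0 \<and> gamma_condition \<sigma> \<omega> r}. ennreal r)"

text \<open>
  The two real-valued suprema below are over bounded sets in all cases of interest:
  for \<open>phi_star\<close> because $\log t = o(\omega(t))$ makes \<open>phi \<omega>\<close> grow faster than
  any linear function, and for \<open>omega_seq\<close> as soon as $M_p^{1/p}\to\infty$, in particular
  for the sequences \<open>hat (weight_matrix \<omega> x)\<close>, which dominate $p!$.
\<close>

definition phi_star :: "(real \<Rightarrow> real) \<Rightarrow> real \<Rightarrow> real" where
  "phi_star \<omega> x = (SUP y\<in>{0..}. x * y - phi \<omega> y)"

definition weight_matrix :: "(real \<Rightarrow> real) \<Rightarrow> real \<Rightarrow> nat \<Rightarrow> real" where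
  "weight_matrix \<omega> l j = exp (1 / l * phi_star \<omega> (l * real j))"

definition hat :: "(nat \<Rightarrow> real) \<Rightarrow> nat \<Rightarrow> real" where
  "hat M p = fact p * M p"

definition omega_seq :: "(nat \<Rightarrow> real) \<Rightarrow> real \<Rightarrow> real" where
  "omega_seq M t = (if t > 0 then (SUP p. ln (t ^ p / M p)) else 0)"

text \<open>
  The Riemann surface of the logarithm is realized as the universal covering
  $\exp : \mathbb{C} \to \mathbb{C} - \{0\}$: a point $z$ of the surface is represented by
  $w = \log|z| + i \arg z$, so that $\arg z$ is \<^term>\<open>Im w\<close>, $|z|$ is \<^term>\<open>exp (Re w)\<close>,
  and the projection of $z$ to the punctured plane, which is the local coordinate on the
  surface, is \<^term>\<open>exp w\<close>. Sectors of arbitrarily large opening become horizontal strips.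
  Since \<open>exp\<close> is locally biholomorphic, holomorphy on the surface is ordinary holomorphy
  in $w$. Derivatives, however, are taken with respect to the coordinate $z$.
\<close>

type_synonym log_surface = complex

definition sector :: "real \<Rightarrow> log_surface set" where
  "sector \<gamma> = {w. \<bar>Im w\<bar> < \<gamma> * pi / 2}"

definition surface_deriv :: "(log_surface \<Rightarrow> complex) \<Rightarrow> log_surface \<Rightarrow> complex" where
  "surface_deriv f w = Lim (at w) (\<lambda>v. (f v - f w) / (exp v - exp w))"

lemma surface_deriv_eq:
  assumes "f field_differentiable (at w)"
  shows "((\<lambda>v. (f v - f w) / (exp v - exp w)) \<longlongrightarrow> deriv f w / exp w) (at w)"
    and "surface_deriv f w = deriv f w / exp w"
proof -
  have f: "((\<lambda>v. (f v - f w) / (v - w)) \<longlongrightarrow> deriv f w) (at w)"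
    using assms by (simp add: DERIV_deriv_iff_field_differentiable [symmetric]
        has_field_derivative_iff)
  have e: "((\<lambda>v. (exp v - exp w) / (v - w)) \<longlongrightarrow> exp w) (at w)"
    using DERIV_exp [of w] by (simp add: has_field_derivative_iff)
  have "((\<lambda>v. ((f v - f w) / (v - w)) / ((exp v - exp w) / (v - w)))
          \<longlongrightarrow> deriv f w / exp w) (at w)"
    by (rule tendsto_divide [OF f e]) simp
  moreover have "\<forall>\<^sub>F v in at w. ((f v - f w) / (v - w)) / ((exp v - exp w) / (v - w))
                   = (f v - f w) / (exp v - exp w)"
    by (simp add: eventually_at_filter)
  ultimately show lim: "((\<lambda>v. (f v - f w) / (exp v - exp w)) \<longlongrightarrow> deriv f w / exp w) (at w)"
    by (rule Lim_transform_eventually)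
  show "surface_deriv f w = deriv f w / exp w"
    unfolding surface_deriv_def by (rule tendsto_Lim [OF _ lim]) simp
qed

definition surface_higher_deriv ::
    "nat \<Rightarrow> (log_surface \<Rightarrow> complex) \<Rightarrow> log_surface \<Rightarrow> complex" where
  "surface_higher_deriv p = surface_deriv ^^ p"

text \<open>$z \to 0$ with $z \in S$, where $z$ projects to \<^term>\<open>exp w\<close>\<close>

definition to_zero_in :: "log_surface set \<Rightarrow> log_surface filter" where
  "to_zero_in S = inf (filtercomap exp (nhds 0)) (principal S)"

definition A_norm ::
    "(real \<Rightarrow> real) \<Rightarrow> real \<Rightarrow> log_surface set \<Rightarrow> (log_surface \<Rightarrow> complex) \<Rightarrow> ennreal" where
  "A_norm \<tau> l S f =
     (SUP (w, p)\<in>S \<times> UNIV. ennreal (norm (surface_higher_deriv p f w) / weight_matrix \<tau> l p))"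

text \<open>
  A function on \<open>S\<close> is represented by its extension by \<open>0\<close>, so that equality and the
  pointwise vector space operations are those of functions on \<open>S\<close>. All sectors are open, so the
  extension does not affect derivatives at points of \<open>S\<close>.
\<close>

definition A_space ::
    "(real \<Rightarrow> real) \<Rightarrow> real \<Rightarrow> log_surface set \<Rightarrow> (log_surface \<Rightarrow> complex) set" where
  "A_space \<tau> l S =
     {f. f holomorphic_on S \<and> (\<forall>w. w \<notin> S \<longrightarrow> f w = 0) \<and> A_norm \<tau> l S f < \<infinity>}"

definition Lambda_norm :: "(real \<Rightarrow> real) \<Rightarrow> real \<Rightarrow> (nat \<Rightarrow> complex) \<Rightarrow> ennreal" where
  "Lambda_norm \<tau> l a = (SUP p. ennreal (norm (a p) / weight_matrix \<tau> l p))"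

definition Lambda_space :: "(real \<Rightarrow> real) \<Rightarrow> real \<Rightarrow> (nat \<Rightarrow> complex) set" where
  "Lambda_space \<tau> l = {a. Lambda_norm \<tau> l a < \<infinity>}"

definition A_union ::
    "(real \<Rightarrow> real) \<Rightarrow> log_surface set \<Rightarrow> (log_surface \<Rightarrow> complex) set" where
  "A_union \<tau> S = (\<Union>l\<in>{0<..}. A_space \<tau> l S)"

definition Lambda_union :: "(real \<Rightarrow> real) \<Rightarrow> (nat \<Rightarrow> complex) set" where
  "Lambda_union \<tau> = (\<Union>l\<in>{0<..}. Lambda_space \<tau> l)"

text \<open>
  For \<open>f \<in> A_space \<tau> l (sector \<gamma>)\<close> the limits exist: each derivative of \<open>f\<close>
  is bounded on the sector, hence each derivative is Lipschitz with respect to path length.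
\<close>

definition borel_map :: "log_surface set \<Rightarrow> (log_surface \<Rightarrow> complex) \<Rightarrow> nat \<Rightarrow> complex" where
  "borel_map S f p = Lim (to_zero_in S) (surface_higher_deriv p f)"

definition linear_map_on ::
    "('a \<Rightarrow> complex) set \<Rightarrow> (('a \<Rightarrow> complex) \<Rightarrow> ('b \<Rightarrow> complex)) \<Rightarrow> bool" where
  "linear_map_on X E \<longleftrightarrow>
     (\<forall>a\<in>X. \<forall>b\<in>X. E (\<lambda>i. a i + b i) = (\<lambda>j. E a j + E b j)) \<and>
     (\<forall>c. \<forall>a\<in>X. E (\<lambda>i. c * a i) = (\<lambda>j. c * E a j))"

definition continuous_map_on ::
    "('a \<Rightarrow> complex) set \<Rightarrow> (('a \<Rightarrow> complex) \<Rightarrow> ennreal) \<Rightarrow> (('b \<Rightarrow> complex) \<Rightarrow> ennreal) \<Rightarrow>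
     (('a \<Rightarrow> complex) \<Rightarrow> ('b \<Rightarrow> complex)) \<Rightarrow> bool" where
  "continuous_map_on X normX normY E \<longleftrightarrow>
     (\<forall>a\<in>X. \<forall>\<epsilon>>0. \<exists>\<delta>>0. \<forall>b\<in>X.
        normX (\<lambda>i. b i - a i) < ennreal \<delta> \<longrightarrow> normY (\<lambda>j. E b j - E a j) < ennreal \<epsilon>)"

end

theory Submission
  imports Defs "HOL-Complex_Analysis.Complex_Analysis"
begin

text \<open>
  The extension is a truncated Laplace transform whose kernel is a power of a flat function.

  Choose \<open>r > \<gamma>\<close> satisfying the growth condition, and work in the strip \<open>\<bar>Im w\<bar> < r \<pi> / 2\<close>
  that represents the sector of opening \<open>r\<close>. Put \<open>\<phi> = \<phi>\<^sub>\<omega>\<close>. The kernel \<open>\<zeta> / (1 + \<zeta>)\<^sup>2\<close> maps the right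
  half-plane into itself, and it is small for \<open>\<zeta>\<close> near \<open>0\<close> and near \<open>\<infinity>\<close>. Hence the series \<open>H\<close> over
  \<open>n\<close> with terms \<open>\<phi> n \<zeta>\<^sub>n / (1 + \<zeta>\<^sub>n)\<^sup>2\<close>, where \<open>\<zeta>\<^sub>n = exp ((w - n) / r)\<close>, defines a holomorphic
  function on the strip with \<open>Re H \<ge> c \<phi> (Re w)\<close>, while the growth condition, compared with a sum, gives
  \<open>H \<le> C \<phi>\<^sub>\<sigma> + C\<close> on the real line (lemma \<open>holomorphic_weight\<close>). So \<open>e = exp (- s H)\<close> is flat with
  respect to \<open>\<omega>\<close>, and its moments \<open>m\<^sub>p\<close> are bounded from below in terms of \<open>\<sigma>\<close>; by the choice of the
  power \<open>s > 0\<close> they dominate any prescribed sequence of the weight matrix of \<open>\<sigma>\<close> up to a geometric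
  factor.

  The formal Borel transform with coefficients \<open>a\<^sub>p / (p! m\<^sub>p)\<close> therefore converges near \<open>0\<close>, and its truncated
  Laplace transform is the sum of \<open>(a\<^sub>p / p!) z\<^sup>p \<Psi>\<^sub>p(L - w) / m\<^sub>p\<close>, where \<open>z = exp w\<close> and \<open>\<Psi>\<^sub>p\<close> is the primitive of
  \<open>v \<mapsto> e(v) exp ((p + 1) v)\<close> that vanishes at the left end of the strip and tends to \<open>m\<^sub>p\<close> at the right
  end (lemmas \<open>decaying_primitive\<close> and \<open>truncated_moments\<close>). Estimating \<open>\<Psi>\<^sub>p\<close> for \<open>p \<ge> N\<close> and
  \<open>m\<^sub>p - \<Psi>\<^sub>p\<close> for \<open>p < N\<close> bounds the remainder after \<open>N\<close> terms by a constant times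
  \<open>B\<^sup>N A\<^sub>N \<bar>z\<bar>\<^sup>N\<close>, where \<open>A\<^sub>N\<close> is controlled by the weight matrix of \<open>\<omega>\<close>
  (lemma \<open>truncated_laplace_expansion\<close>). Cauchy's estimate turns these bounds into bounds for the derivatives
  on the smaller sector of opening \<open>\<gamma>\<close> and identifies their limits at \<open>0\<close>
  (lemma \<open>expansion_derivatives\<close>).

  Finally, up to geometric factors, the \<open>k\<close>-th sequence of the weight matrix of \<open>\<tau>\<^sub>2\<close> is
  \<open>p! W\<^sub>p\<close> with index \<open>k x\<^sub>2\<close>, and similarly for \<open>\<tau>\<^sub>1\<close> and \<open>\<sigma>\<close>; geometric factors are absorbed by increasing
  the index, because \<open>\<omega>(2t) = O(\<omega>(t))\<close> (lemmas \<open>weight_matrix_omega_seq_le\<close> and \<open>weight_absorb\<close>).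
\<close>

section \<open>Weight functions and weight matrices\<close>

lemma class_W_D:
  assumes "\<omega> \<in> class_W"
  shows phi_nonneg: "phi \<omega> x \<ge> 0"
    and phi_mono: "x \<le> y \<Longrightarrow> phi \<omega> x \<le> phi \<omega> y"
    and phi_eq_0: "x \<le> 0 \<Longrightarrow> phi \<omega> x = 0"
  using assms
  by (auto simp: class_W_def weight_function_def normalized_def phi_def mono_on_def)

lemma phi_superlinear:
  assumes W: "\<omega> \<in> class_W" and "\<epsilon> > 0"
  obtains C where "C \<ge> 0" "\<And>x. x \<le> \<epsilon> * phi \<omega> x + C"
proof -
  have "\<forall>\<^sub>F t in at_top. norm (ln t) \<le> \<epsilon> * norm (\<omega> t)"
    using W \<open>\<epsilon> > 0\<close> by (auto simp: class_W_def dest: landau_o.smallD)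
  then obtain T where T: "\<And>t. t \<ge> T \<Longrightarrow> \<bar>ln t\<bar> \<le> \<epsilon> * \<bar>\<omega> t\<bar>"
    by (auto simp: eventually_at_top_linorder)
  define C where "C = ln (max T 1)"
  have "C \<ge> 0" by (simp add: C_def)
  moreover have "x \<le> \<epsilon> * phi \<omega> x + C" for x
  proof (cases "exp x \<ge> T")
    case True
    have "x \<le> \<epsilon> * phi \<omega> x"
      using T[OF True] phi_nonneg[OF W, of x] by (simp add: phi_def)
    then show ?thesis using \<open>C \<ge> 0\<close> by simp
  next
    case False
    then have "x \<le> C" unfolding C_def
      by (subst ln_ge_iff) auto
    moreover have "0 \<le> \<epsilon> * phi \<omega> x"
      using phi_nonneg[OF W, of x] \<open>\<epsilon> > 0\<close> by simp
    ultimately show ?thesis by linarith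
  qed
  ultimately show thesis using that by blast
qed

lemma bigo_phi:
  assumes W: "\<omega> \<in> class_W" "\<sigma> \<in> class_W" and "(\<lambda>t. \<omega> (c * t)) \<in> O[at_top](\<sigma>)" "c > 0"
  obtains D where "D \<ge> 1" "\<And>x. phi \<omega> (x + ln c) \<le> D * phi \<sigma> x + D"
proof -
  obtain c' where c': "c' > 0" and ev: "\<forall>\<^sub>F t in at_top. norm (\<omega> (c * t)) \<le> c' * norm (\<sigma> t)"
    using assms(3) by (rule landau_o.bigE)
  then obtain T where T: "\<And>t. t \<ge> T \<Longrightarrow> \<bar>\<omega> (c * t)\<bar> \<le> c' * \<bar>\<sigma> t\<bar>"
    by (auto simp: eventually_at_top_linorder)
  define T1 where "T1 = ln (max T 1)"
  define D where "D = max 1 (max c' (phi \<omega> (T1 + ln c)))"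
  have D: "D \<ge> 1" "D \<ge> c'" "D \<ge> phi \<omega> (T1 + ln c)" by (auto simp: D_def)
  have "phi \<omega> (x + ln c) \<le> D * phi \<sigma> x + D" for x
  proof (cases "exp x \<ge> T")
    case True
    have "phi \<omega> (x + ln c) \<le> c' * phi \<sigma> x"
      using T[OF True] phi_nonneg[OF W(2), of x] \<open>c > 0\<close>
      by (simp add: phi_def exp_add mult.commute)
    also have "\<dots> \<le> D * phi \<sigma> x"
      using D phi_nonneg[OF W(2), of x] by (intro mult_right_mono) auto
    finally show ?thesis using D by simp
  next
    case False
    then have "x \<le> T1" unfolding T1_def by (subst ln_ge_iff) auto
    then have "phi \<omega> (x + ln c) \<le> phi \<omega> (T1 + ln c)"
      by (intro phi_mono[OF W(1)]) auto
    also have "\<dots> \<le> D" by (rule D)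
    also have "\<dots> \<le> D * phi \<sigma> x + D"
      using D phi_nonneg[OF W(2), of x] by simp
    finally show ?thesis .
  qed
  with D that show thesis by blast
qed

lemma phi_shift:
  assumes W: "\<omega> \<in> class_W"
  obtains D where "D \<ge> 1" "\<And>x. phi \<omega> (x + h) \<le> D * phi \<omega> x + D"
proof -
  have "(\<lambda>t. \<omega> (2 * t)) \<in> O[at_top](\<omega>)" using W by (simp add: class_W_def)
  then obtain D where D: "D \<ge> 1" "\<And>x. phi \<omega> (x + ln 2) \<le> D * phi \<omega> x + D"
    using bigo_phi[OF W W, of 2] by auto
  have iter: "\<exists>E\<ge>1. \<forall>x. phi \<omega> (x + real n * ln 2) \<le> E * phi \<omega> x + E" for n
  proof (induction n)
    case 0
    show ?case using phi_nonneg[OF W] by (intro exI[of _ 1]) auto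
  next
    case (Suc n)
    then obtain E where E: "E \<ge> 1" "\<And>x. phi \<omega> (x + real n * ln 2) \<le> E * phi \<omega> x + E"
      by auto
    have "phi \<omega> (x + real (Suc n) * ln 2) \<le> (2 * D * E) * phi \<omega> x + 2 * D * E" for x
    proof -
      have "phi \<omega> (x + real (Suc n) * ln 2) = phi \<omega> ((x + real n * ln 2) + ln 2)"
        by (simp add: algebra_simps)
      also have "\<dots> \<le> D * (E * phi \<omega> x + E) + D"
        using D E(2)[of x] by (smt (verit) mult_left_mono)
      also have "\<dots> \<le> (2 * D * E) * phi \<omega> x + 2 * D * E"
      proof -
        have "D \<le> D * E" using D E by simp
        moreover have "0 \<le> D * E * phi \<omega> x" using D E phi_nonneg[OF W] by simp
        ultimately show ?thesis by (simp add: algebra_simps)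
      qed
      finally show ?thesis .
    qed
    moreover have "2 * D * E \<ge> 1" using D E by (smt (verit) mult_le_cancel_left1)
    ultimately show ?case by blast
  qed
  define n where "n = nat \<lceil>h / ln 2\<rceil>"
  have "h \<le> real n * ln 2"
    by (simp add: n_def pos_divide_le_eq[symmetric]) linarith
  then have "phi \<omega> (x + h) \<le> phi \<omega> (x + real n * ln 2)" for x
    by (intro phi_mono[OF W]) auto
  then show thesis using iter[of n] that by (metis order_trans)
qed

lemma weight_matrix_le:
  assumes "l > 0" and "\<And>y. y \<ge> 0 \<Longrightarrow> real j * y - phi \<tau> y / l \<le> B"
  shows "weight_matrix \<tau> l j \<le> exp B"
proof -
  have "phi_star \<tau> (l * real j) \<le> l * B"
    unfolding phi_star_def
  proof (rule cSUP_least)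
    fix y :: real assume "y \<in> {0..}"
    then have "l * (real j * y - phi \<tau> y / l) \<le> l * B"
      using assms by (intro mult_left_mono) auto
    then show "l * real j * y - phi \<tau> y \<le> l * B"
      using \<open>l > 0\<close> by (simp add: algebra_simps)
  qed auto
  then show ?thesis
    using \<open>l > 0\<close> by (simp add: weight_matrix_def divide_simps mult.commute)
qed

lemma weight_matrix_ge:
  assumes "l > 0" and "\<And>y. y \<ge> 0 \<Longrightarrow> real j * y - phi \<tau> y / l \<le> B" and "y \<ge> 0"
  shows "exp (real j * y - phi \<tau> y / l) \<le> weight_matrix \<tau> l j"
proof -
  have "bdd_above ((\<lambda>y. l * real j * y - phi \<tau> y) ` {0..})"
  proof (rule bdd_aboveI2)
    fix y :: real assume "y \<in> {0..}"
    then have "l * (real j * y - phi \<tau> y / l) \<le> l * B"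
      using assms by (intro mult_left_mono) auto
    then show "l * real j * y - phi \<tau> y \<le> l * B"
      using \<open>l > 0\<close> by (simp add: algebra_simps)
  qed
  then have "l * real j * y - phi \<tau> y \<le> phi_star \<tau> (l * real j)"
    unfolding phi_star_def using \<open>y \<ge> 0\<close> by (intro cSUP_upper) auto
  then have "(l * real j * y - phi \<tau> y) / l \<le> phi_star \<tau> (l * real j) / l"
    using \<open>l > 0\<close> by (intro divide_right_mono) auto
  then show ?thesis
    using \<open>l > 0\<close> by (simp add: weight_matrix_def diff_divide_distrib)
qed

lemma class_W_weight_matrix_ge:
  assumes W: "\<omega> \<in> class_W" and "l > 0" "y \<ge> 0"
  shows "exp (real j * y - phi \<omega> y / l) \<le> weight_matrix \<omega> l j"
proof -
  define m where "m = real j + 1"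
  have "m > 0" by (simp add: m_def)
  then obtain C where C: "\<And>y. y \<le> (1 / (l * m)) * phi \<omega> y + C" and "C \<ge> 0"
    using phi_superlinear[OF W, of "1 / (l * m)"] \<open>l > 0\<close> by auto
  show ?thesis
  proof (rule weight_matrix_ge[OF \<open>l > 0\<close> _ \<open>y \<ge> 0\<close>])
    fix z :: real assume "z \<ge> 0"
    then have "real j * z \<le> m * z" by (intro mult_right_mono) (auto simp: m_def)
    also have "\<dots> \<le> m * ((1 / (l * m)) * phi \<omega> z + C)"
      using C[of z] \<open>m > 0\<close> by (intro mult_left_mono) auto
    also have "\<dots> = phi \<omega> z / l + m * C"
      using \<open>l > 0\<close> \<open>m > 0\<close> by (simp add: field_simps)
    finally show "real j * z - phi \<omega> z / l \<le> m * C" by simp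
  qed
qed

lemma weight_matrix_pos: "weight_matrix \<tau> l j > 0"
  by (simp add: weight_matrix_def)

lemma weight_matrix_scale:
  assumes "x > 0" "k > 0"
  shows "ln (weight_matrix \<omega> x (k * p)) / real k = ln (weight_matrix \<omega> (real k * x) p)"
  using assms by (simp add: weight_matrix_def ac_simps)

lemma power_le_exp_fact:
  fixes x :: real
  assumes "x \<ge> 0"
  shows "x ^ n \<le> exp x * fact n"
proof -
  have "(\<Sum>i<Suc n. x ^ i / fact i) \<le> (\<Sum>i. x ^ i / fact i)"
    using summable_exp[of x] assms
    by (intro sum_le_suminf) (auto simp: field_simps)
  moreover have "x ^ n / fact n \<le> (\<Sum>i<Suc n. x ^ i / fact i)"
    using assms by (intro member_le_sum) auto
  ultimately have "x ^ n / fact n \<le> exp x"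
    by (simp add: exp_def scaleR_conv_of_real field_simps)
  then show ?thesis by (simp add: field_simps)
qed

text \<open>Bounds for \<open>\<omega>\<^sub>M\<close>, where \<open>M = (p! W\<^sup>x\<^sub>p)\<^sub>p\<close>, in the variable \<open>y = log t\<close>. The lower bound is the
  definition, once the supremum is known to be finite; the upper one combines
  \<open>log W\<^sup>x\<^sub>q \<ge> q v - \<phi> v / x\<close> with \<open>u\<^sup>q / q! \<le> exp u\<close> for \<open>u = exp (y - v)\<close>.\<close>

lemma phi_omega_seq:
  assumes W: "\<omega> \<in> class_W" and "x > 0"
  defines "M \<equiv> hat (weight_matrix \<omega> x)"
  shows phi_omega_seq_ge: "real q * y - ln (M q) \<le> phi (omega_seq M) y"
    and phi_omega_seq_le: "v \<ge> 0 \<Longrightarrow> phi (omega_seq M) y \<le> phi \<omega> v / x + exp (y - v)"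
proof -
  have Mpos: "M q > 0" for q using weight_matrix_pos by (simp add: M_def hat_def)
  have eq: "phi (omega_seq M) y = (SUP q. real q * y - ln (M q))"
    using Mpos
    by (simp add: phi_def omega_seq_def ln_div less_imp_neq[symmetric] exp_of_nat_mult[symmetric])
  have up: "real q * y - ln (M q) \<le> phi \<omega> v / x + exp (y - v)" if "v \<ge> 0" for v q
  proof -
    have "real q * v - phi \<omega> v / x \<le> ln (weight_matrix \<omega> x q)"
      using class_W_weight_matrix_ge[OF W \<open>x > 0\<close> that, of q] weight_matrix_pos[of \<omega> x q]
      by (simp add: ln_ge_iff)
    moreover have "real q * (y - v) - ln (fact q) \<le> exp (y - v)"
    proof -
      have "exp (y - v) ^ q \<le> exp (exp (y - v)) * fact q"
        by (rule power_le_exp_fact) simp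
      then have "ln (exp (y - v) ^ q) \<le> ln (exp (exp (y - v)) * fact q)"
        by (subst ln_le_cancel_iff) auto
      then show ?thesis by (simp add: ln_realpow ln_mult)
    qed
    moreover have "ln (M q) = ln (fact q) + ln (weight_matrix \<omega> x q)"
      using weight_matrix_pos[of \<omega> x q] by (simp add: M_def hat_def ln_mult)
    ultimately show ?thesis by (simp add: algebra_simps)
  qed
  then have "bdd_above (range (\<lambda>q. real q * y - ln (M q)))"
    using up[of 0] by (intro bdd_aboveI2) auto
  then show "real q * y - ln (M q) \<le> phi (omega_seq M) y"
    unfolding eq by (intro cSUP_upper) auto
  show "phi (omega_seq M) y \<le> phi \<omega> v / x + exp (y - v)" if "v \<ge> 0"
    unfolding eq using up[OF that] by (intro cSUP_least) auto
qed

lemma weight_matrix_omega_seq_bound: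
  assumes W: "\<omega> \<in> class_W" and "x > 0" "l > 0" "y \<ge> 0" "real q \<ge> l * real p"
  defines "M \<equiv> hat (weight_matrix \<omega> x)"
  shows "real p * y - phi (omega_seq M) y / l \<le> ln (M q) / l"
proof -
  have "l * (real p * y) - phi (omega_seq M) y \<le> ln (M q)"
    using phi_omega_seq_ge[OF W \<open>x > 0\<close>, of q y] mult_right_mono[OF assms(5) \<open>y \<ge> 0\<close>]
    unfolding M_def by (simp add: ac_simps)
  then have "(l * (real p * y) - phi (omega_seq M) y) / l \<le> ln (M q) / l"
    using \<open>l > 0\<close> by (intro divide_right_mono) auto
  then show ?thesis using \<open>l > 0\<close> by (simp add: diff_divide_distrib)
qed

text \<open>Up to geometric factors, the sequence with index \<open>k \<ge> 1\<close> in the weight matrix of \<open>\<omega>\<^sub>M\<close>, for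
  \<open>M = (p! W\<^sup>x\<^sub>p)\<^sub>p\<close>, is \<open>p! W\<^sup>k\<^sup>x\<^sub>p\<close>. The upper estimate tests the supremum defining \<open>\<omega>\<^sub>M\<close>
  at the index \<open>k p\<close>; the lower one tests the conjugate at \<open>y = v + log (p + 1)\<close>.\<close>

lemma weight_matrix_omega_seq_le:
  assumes W: "\<omega> \<in> class_W" and "x > 0" "l > 0" "real k \<ge> l"
  shows "weight_matrix (omega_seq (hat (weight_matrix \<omega> x))) l p
           \<le> exp (real p * ln (exp 1 * k)) * fact p * weight_matrix \<omega> (k * x) p"
proof -
  define M where "M = hat (weight_matrix \<omega> x)"
  have k: "real k > 0" "k > 0" using assms by (auto simp: less_le_trans)
  have tau0: "0 \<le> phi (omega_seq M) y" for y
    using phi_omega_seq_ge[OF W \<open>x > 0\<close>, of 0 y]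
      weight_matrix_le[of x 0 \<omega> 0] \<open>x > 0\<close> phi_nonneg[OF W]
    by (simp add: M_def hat_def) (smt (verit) ln_le_zero_iff weight_matrix_pos)
  have "ln (fact (k * p)) / real k \<le> real p * ln (exp 1 * k) + ln (fact p)"
  proof (cases "p = 0")
    case False
    have "fact (k * p) \<le> (real (k * p)) ^ (k * p)"
      by (metis fact_le_power le_refl of_nat_fact of_nat_le_iff of_nat_power)
    then have "ln (fact (k * p)) \<le> ln ((real (k * p)) ^ (k * p))"
      using k False by (subst ln_le_cancel_iff) auto
    also have "\<dots> = real k * (real p * ln (real k) + real p * ln (real p))"
      using k False by (simp add: ln_realpow ln_mult algebra_simps)
    finally have "ln (fact (k * p)) / real k \<le> real p * ln (real k) + real p * ln (real p)"
      using k by (simp add: field_simps)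
    moreover have "real p * ln (real p) \<le> real p + ln (fact p)"
    proof -
      have "ln (real p ^ p) \<le> ln (exp (real p) * fact p)"
        using power_le_exp_fact[of "real p" p] False by (subst ln_le_cancel_iff) auto
      then show ?thesis using False by (simp add: ln_realpow ln_mult)
    qed
    ultimately show ?thesis using k by (simp add: ln_mult algebra_simps)
  qed auto
  then have Mk: "ln (M (k * p)) / k \<le>
      real p * ln (exp 1 * k) + ln (fact p) + ln (weight_matrix \<omega> (k * x) p)"
    using weight_matrix_scale[OF \<open>x > 0\<close> k(2), of \<omega> p] weight_matrix_pos[of \<omega> x "k*p"]
    by (simp add: M_def hat_def ln_mult add_divide_distrib)
  have "weight_matrix (omega_seq M) l p \<le>
      exp (real p * ln (exp 1 * k) + ln (fact p) + ln (weight_matrix \<omega> (k * x) p))"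
  proof (rule weight_matrix_le[OF \<open>l > 0\<close>])
    fix y :: real assume "y \<ge> 0"
    have "real p * y - phi (omega_seq M) y / l \<le> real p * y - phi (omega_seq M) y / k"
      using tau0[of y] assms by (simp add: frac_le)
    also have "\<dots> \<le> ln (M (k * p)) / k"
      unfolding M_def
      by (rule weight_matrix_omega_seq_bound[OF W \<open>x > 0\<close> k(1) \<open>y \<ge> 0\<close>]) simp
    also note Mk
    finally show "real p * y - phi (omega_seq M) y / l \<le>
      real p * ln (exp 1 * k) + ln (fact p) + ln (weight_matrix \<omega> (k * x) p)" .
  qed
  then show ?thesis
    using weight_matrix_pos[of \<omega> "k * x" p] by (simp add: M_def exp_add)
qed

lemma weight_matrix_omega_seq_ge:
  assumes W: "\<omega> \<in> class_W" and "x > 0" "k \<ge> 1" "v \<ge> 0"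
  shows "exp (- real (Suc p)) * fact p * exp (real p * v - phi \<omega> v / (k * x))
           \<le> weight_matrix (omega_seq (hat (weight_matrix \<omega> x))) k p"
proof -
  define \<tau> where "\<tau> = omega_seq (hat (weight_matrix \<omega> x))"
  define y where "y = v + ln (real (Suc p))"
  have "y \<ge> 0" using \<open>v \<ge> 0\<close> by (simp add: y_def)
  have "k > 0" using \<open>k \<ge> 1\<close> by simp
  have "ln (fact p) \<le> real p * ln (real (Suc p))"
  proof -
    have "fact p \<le> (real p) ^ p"
      by (metis fact_le_power le_refl of_nat_fact of_nat_le_iff of_nat_power)
    also have "\<dots> \<le> real (Suc p) ^ p" by (intro power_mono) auto
    finally have "ln (fact p) \<le> ln (real (Suc p) ^ p)"
      by (subst ln_le_cancel_iff) auto
    then show ?thesis by (simp add: ln_realpow)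
  qed
  moreover have "phi \<tau> y / k \<le> phi \<omega> v / (k * x) + real (Suc p)"
  proof -
    have "phi \<tau> y \<le> phi \<omega> v / x + real (Suc p)"
      using phi_omega_seq_le[OF W \<open>x > 0\<close> \<open>v \<ge> 0\<close>, of y] by (simp add: \<tau>_def y_def)
    then have "phi \<tau> y / k \<le> (phi \<omega> v / x + real (Suc p)) / k"
      using \<open>k > 0\<close> by (intro divide_right_mono) auto
    also have "\<dots> = phi \<omega> v / (k * x) + real (Suc p) / k"
      by (simp add: add_divide_distrib mult.commute)
    also have "real (Suc p) / k \<le> real (Suc p)"
      using \<open>k \<ge> 1\<close> by (simp add: divide_le_eq mult_le_cancel_left1)
    finally show ?thesis by simp
  qed
  ultimately have "ln (fact p) + (real p * v - phi \<omega> v / (k * x)) - real (Suc p)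
      \<le> real p * y - phi \<tau> y / k"
    by (simp add: y_def algebra_simps)
  then have "exp (ln (fact p) + (real p * v - phi \<omega> v / (k * x)) - real (Suc p))
      \<le> exp (real p * y - phi \<tau> y / k)"
    by simp
  also have "\<dots> \<le> weight_matrix \<tau> k p"
  proof (rule weight_matrix_ge[OF \<open>k > 0\<close> _ \<open>y \<ge> 0\<close>])
    fix z :: real assume "z \<ge> 0"
    then show "real p * z - phi \<tau> z / k
        \<le> ln (hat (weight_matrix \<omega> x) (nat \<lceil>k * real p\<rceil>)) / k"
      unfolding \<tau>_def
      by (intro weight_matrix_omega_seq_bound[OF W \<open>x > 0\<close> \<open>k > 0\<close>]) (auto intro: real_nat_ceiling_ge)
  qed
  finally show ?thesis
    by (simp add: \<tau>_def exp_add exp_diff exp_minus field_simps)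
qed

text \<open>Geometric factors \<open>exp (h p)\<close> and a bounded shift of the exponent \<open>p\<close> are absorbed by passing
  to a larger index \<open>k\<close>: the former by \<open>\<omega>(2t) = O(\<omega>(t))\<close>, the latter by \<open>log t = o(\<omega>(t))\<close>. The
  factor \<open>exp \<bar>u\<bar>\<close> later provides the decay needed for integrating over \<open>u\<close>.\<close>

lemma weight_absorb:
  assumes W: "\<omega> \<in> class_W" and "x > 0" "\<kappa> > 0" "h \<ge> 0"
  obtains C k where "k \<ge> 1" "C > 0"
    "\<And>p u. exp (h * real p) * exp (real (Suc p) * u + \<bar>u\<bar> - \<kappa> * phi \<omega> u) * fact p
        \<le> C * weight_matrix (omega_seq (hat (weight_matrix \<omega> x))) k p"
proof -
  define h' where "h' = h + 1"
  obtain D where D: "D \<ge> 1" "\<And>u. phi \<omega> (u + h') \<le> D * phi \<omega> u + D"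
    using phi_shift[OF W, of h'] by blast
  obtain C0 where C0: "C0 \<ge> 0" "\<And>u. u \<le> (\<kappa> / 4) * phi \<omega> u + C0"
    using phi_superlinear[OF W, of "\<kappa> / 4"] \<open>\<kappa> > 0\<close> by auto
  define k where "k = max 1 (2 * D / (\<kappa> * x))"
  have "k \<ge> 1" by (simp add: k_def)
  have "2 * D / (\<kappa> * x) \<le> k" by (simp add: k_def)
  then have kx: "D / (k * x) \<le> \<kappa> / 2"
    using \<open>x > 0\<close> \<open>\<kappa> > 0\<close> \<open>k \<ge> 1\<close> by (simp add: field_simps)
  define C where "C = exp (2 * C0 + \<kappa> + 1)"
  have main: "h * real p + (real (Suc p) * u + \<bar>u\<bar> - \<kappa> * phi \<omega> u) + real (Suc p)
      \<le> (2 * C0 + \<kappa> + 1) + (real p * v - phi \<omega> v / (k * x))"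
    if v: "v = max 0 (u + h')" for p u v
  proof (cases "u + h' \<ge> 0")
    case True
    then have v: "v = u + h'" using v by simp
    have "u + \<bar>u\<bar> \<le> (\<kappa> / 2) * phi \<omega> u + 2 * C0"
      using C0(2)[of u] C0(1) phi_nonneg[OF W, of u] \<open>\<kappa> > 0\<close> by (cases "u \<ge> 0") auto
    moreover have "phi \<omega> v / (k * x) \<le> (\<kappa> / 2) * phi \<omega> u + \<kappa> / 2"
    proof -
      have "phi \<omega> v / (k * x) \<le> (D * phi \<omega> u + D) / (k * x)"
        using D(2)[of u] v \<open>x > 0\<close> \<open>k \<ge> 1\<close> by (intro divide_right_mono) auto
      also have "\<dots> = D / (k * x) * (phi \<omega> u + 1)" by (simp add: field_simps)
      also have "\<dots> \<le> (\<kappa> / 2) * (phi \<omega> u + 1)"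
        using kx phi_nonneg[OF W, of u] by (intro mult_right_mono) auto
      finally show ?thesis by (simp only: distrib_left mult_1_right)
    qed
    moreover have "h * real p + real p * u + real p = real p * v"
      by (simp add: v h'_def algebra_simps)
    ultimately show ?thesis using \<open>\<kappa> > 0\<close> by (simp add: algebra_simps)
  next
    case False
    have u: "u < 0" using False \<open>h \<ge> 0\<close> by (simp add: h'_def)
    have "h * real p + real p * u + real p = real p * (u + h')"
      by (simp add: h'_def algebra_simps)
    also have "\<dots> \<le> 0" using False by (intro mult_nonneg_nonpos) auto
    finally have "h * real p + real p * u + real p \<le> 0" .
    moreover have "v = 0" "phi \<omega> v = 0" using False v phi_eq_0[OF W, of 0] by auto
    ultimately show ?thesis
      using u C0(1) \<open>\<kappa> > 0\<close> phi_eq_0[OF W, of u] by (simp add: algebra_simps)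
  qed
  have "exp (h * real p) * exp (real (Suc p) * u + \<bar>u\<bar> - \<kappa> * phi \<omega> u) * fact p
        \<le> C * weight_matrix (omega_seq (hat (weight_matrix \<omega> x))) k p" for p u
  proof -
    define v where "v = max 0 (u + h')"
    have "v \<ge> 0" by (simp add: v_def)
    have "exp (h * real p) * exp (real (Suc p) * u + \<bar>u\<bar> - \<kappa> * phi \<omega> u)
        \<le> C * (exp (- real (Suc p)) * exp (real p * v - phi \<omega> v / (k * x)))"
      using main[OF v_def, of p] unfolding C_def exp_add[symmetric]
      by (simp add: algebra_simps)
    then have "exp (h * real p) * exp (real (Suc p) * u + \<bar>u\<bar> - \<kappa> * phi \<omega> u) * fact p
        \<le> C * (exp (- real (Suc p)) * exp (real p * v - phi \<omega> v / (k * x))) * fact p"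
      by (intro mult_right_mono) auto
    also have "\<dots> = C * (exp (- real (Suc p)) * fact p * exp (real p * v - phi \<omega> v / (k * x)))"
      by simp
    also have "\<dots> \<le> C * weight_matrix (omega_seq (hat (weight_matrix \<omega> x))) k p"
      using weight_matrix_omega_seq_ge[OF W \<open>x > 0\<close> \<open>k \<ge> 1\<close> \<open>v \<ge> 0\<close>, of p]
      by (intro mult_left_mono) (auto simp: C_def)
    finally show ?thesis .
  qed
  then show thesis using that[of k C] \<open>k \<ge> 1\<close> by (simp add: C_def)
qed

section \<open>A holomorphic function with real part comparable to the weight\<close>

text \<open>The kernel \<open>\<zeta> / (1 + \<zeta>)\<^sup>2\<close> in the variable \<open>v = log \<zeta>\<close>. It takes the right half-plane into
  itself and is small for small and for large \<open>\<zeta>\<close>.\<close>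

definition kern :: "complex \<Rightarrow> complex" where
  "kern v = exp v / (1 + exp v) ^ 2"

lemma one_plus_exp_nonzero:
  assumes "\<bar>Im v\<bar> \<le> pi / 2"
  shows "1 + exp v \<noteq> 0"
proof -
  have "Re (1 + exp v) \<ge> 1"
    using cos_ge_zero[of "Im v"] assms by (simp add: Re_exp)
  then show ?thesis by (metis not_one_le_zero zero_complex.sel(1))
qed

lemma
  assumes Im: "\<bar>Im v\<bar> \<le> pi / 2"
  shows norm_kern_le: "norm (kern v) \<le> exp (- \<bar>Re v\<bar>)"
    and Re_kern_ge: "Re (kern v) \<ge> 2 * exp (2 * Re v) / (1 + exp (Re v)) ^ 4"
proof -
  define z where "z = exp v"
  define \<rho> where "\<rho> = exp (Re v)"
  have "\<rho> > 0" by (simp add: \<rho>_def)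
  have z: "norm z = \<rho>" by (simp add: z_def \<rho>_def)
  have Re: "Re z \<ge> 0" using cos_ge_zero[of "Im v"] Im by (simp add: z_def Re_exp)
  have sq: "Re z ^ 2 + Im z ^ 2 = \<rho> ^ 2" by (simp add: z[symmetric] cmod_power2)
  have n1: "norm (1 + z) ^ 2 = 1 + 2 * Re z + \<rho> ^ 2"
    by (simp add: cmod_power2 sq[symmetric]) (simp add: power2_eq_square algebra_simps)
  have n1': "norm ((1 + z) ^ 2) = 1 + 2 * Re z + \<rho> ^ 2" by (simp add: norm_power n1)
  have pos: "1 + \<rho> ^ 2 > 0" by (simp add: add_pos_nonneg)
  have "norm (kern v) = \<rho> / (1 + 2 * Re z + \<rho> ^ 2)"
    by (simp add: kern_def z_def[symmetric] norm_divide n1' z)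
  also have "\<dots> \<le> \<rho> / (1 + \<rho> ^ 2)"
    using Re \<open>\<rho> > 0\<close> pos by (intro divide_left_mono) auto
  also have "\<dots> \<le> exp (- \<bar>Re v\<bar>)"
  proof (cases "Re v \<ge> 0")
    case True
    have "\<rho> / (1 + \<rho> ^ 2) \<le> \<rho> / \<rho> ^ 2"
      using \<open>\<rho> > 0\<close> pos by (intro divide_left_mono) auto
    also have "\<dots> = 1 / \<rho>" by (simp add: power2_eq_square)
    finally show ?thesis using True by (simp add: \<rho>_def exp_minus inverse_eq_divide)
  next
    case False
    have "\<rho> / (1 + \<rho> ^ 2) \<le> \<rho> / 1"
      using \<open>\<rho> > 0\<close> pos by (intro divide_left_mono) auto
    then show ?thesis using False by (simp add: \<rho>_def)
  qed
  finally show "norm (kern v) \<le> exp (- \<bar>Re v\<bar>)" .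
  have num: "Re (z * cnj ((1 + z) ^ 2)) = Re z * (1 + \<rho> ^ 2) + 2 * \<rho> ^ 2"
    unfolding sq[symmetric] by (simp add: power2_eq_square algebra_simps)
  have "kern v = (z * cnj ((1 + z) ^ 2)) / of_real ((norm ((1 + z) ^ 2)) ^ 2)"
    unfolding kern_def z_def[symmetric] by (subst complex_div_cnj) simp
  then have "Re (kern v) = Re (z * cnj ((1 + z) ^ 2)) / (norm ((1 + z) ^ 2)) ^ 2"
    by (simp only: Re_divide_of_real)
  also have "\<dots> = (Re z * (1 + \<rho> ^ 2) + 2 * \<rho> ^ 2) / (1 + 2 * Re z + \<rho> ^ 2) ^ 2"
    by (simp only: num n1')
  also have "\<dots> \<ge> (2 * \<rho> ^ 2) / ((1 + \<rho>) ^ 2) ^ 2"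
  proof (rule frac_le)
    have "Re z \<le> \<rho>" using complex_Re_le_cmod[of z] z by simp
    then have "1 + 2 * Re z + \<rho> ^ 2 \<le> (1 + \<rho>) ^ 2"
      by (simp add: power2_eq_square algebra_simps)
    then show "(1 + 2 * Re z + \<rho> ^ 2) ^ 2 \<le> ((1 + \<rho>) ^ 2) ^ 2"
      using Re by (intro power_mono) auto
    have "1 + 2 * Re z + \<rho> ^ 2 > 0" using Re pos by linarith
    then show "0 < (1 + 2 * Re z + \<rho> ^ 2) ^ 2" by simp
  qed (use Re in auto)
  finally show "Re (kern v) \<ge> 2 * exp (2 * Re v) / (1 + exp (Re v)) ^ 4"
    by (simp add: \<rho>_def exp_double)
qed

lemma Re_kern_nonneg:
  assumes "\<bar>Im v\<bar> \<le> pi / 2"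
  shows "Re (kern v) \<ge> 0"
  by (rule order_trans[OF _ Re_kern_ge[OF assms]]) auto

text \<open>The integral in the growth condition dominates a sum over the integers \<open>n \<ge> x\<close>, since
  \<open>\<omega>\<close> is monotone and the disjoint intervals \<open>[exp (n - x), exp (n + 1 - x))\<close> lie in \<open>[1, \<infinity>)\<close>. The
  terms with \<open>n < x\<close> are controlled by a geometric series.\<close>

lemma gamma_condition_sum:
  assumes W: "\<omega> \<in> class_W" "\<sigma> \<in> class_W" and O: "\<omega> \<in> O[at_top](\<sigma>)"
    and "r > 0" and g: "gamma_condition \<sigma> \<omega> r"
  obtains C where "C > 0"
    "\<And>x N. (\<Sum>n<N. phi \<omega> (real n) * exp (- (1 / r) * \<bar>x - real n\<bar>)) \<le> C * phi \<sigma> x + C"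
proof -
  define a where "a = 1 / r"
  have "a > 0" using \<open>r > 0\<close> by (simp add: a_def)
  obtain C0 where "C0 > 0" and C0: "\<And>t. t \<ge> 0 \<Longrightarrow>
     (\<integral>\<^sup>+u\<in>{1..}. ennreal (\<omega> (t * u) / u powr (1 + a)) \<partial>lborel) \<le> ennreal (C0 * \<sigma> t + C0)"
    using g by (auto simp: gamma_condition_def a_def)
  obtain D where D: "D \<ge> 1" "\<And>x. phi \<omega> (x + ln 1) \<le> D * phi \<sigma> x + D"
    using bigo_phi[OF W, of 1] O by auto
  define c where "c = (exp 1 - 1) * exp (- (1 + a))"
  have "c > 0" by (simp add: c_def)
  define q where "q = 1 / (1 - exp (- a))"
  have "q > 0" using \<open>a > 0\<close> by (simp add: q_def)
  have right: "c * (\<Sum>n | n < N \<and> x \<le> real n. phi \<omega> n * exp (- a * \<bar>x - real n\<bar>))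
      \<le> C0 * phi \<sigma> x + C0" for x N
  proof -
    define J where "J = {n. n < N \<and> x \<le> real n}"
    define I where "I n = {exp (real n - x)..<exp (real n + 1 - x)}" for n
    define d where "d n = phi \<omega> n * exp (- (1 + a) * (real n + 1 - x))" for n
    have "finite J" by (simp add: J_def)
    have d0: "d n \<ge> 0" for n by (simp add: d_def phi_nonneg[OF W(1)])
    have disj: "m = n" if "u \<in> I m" "u \<in> I n" for u m n
    proof -
      have "exp (real m - x) < exp (real n + 1 - x)" "exp (real n - x) < exp (real m + 1 - x)"
        using that unfolding I_def by (meson atLeastLessThan_iff le_less_trans)+
      then have "real m < real n + 1" "real n < real m + 1" by auto
      then show ?thesis by linarith
    qed
    have pt: "(\<Sum>n\<in>J. ennreal (d n) * indicator (I n) u)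
        \<le> ennreal (\<omega> (exp x * u) / u powr (1 + a)) * indicator {1..} u" for u
    proof (cases "\<exists>n\<in>J. u \<in> I n")
      case True
      then obtain n where n: "n \<in> J" "u \<in> I n" by auto
      have "(\<Sum>m\<in>J. ennreal (d m) * indicator (I m) u) = (\<Sum>m\<in>J. if m = n then ennreal (d n) else 0)"
        using n disj by (intro sum.cong) (auto simp: indicator_def)
      also have "\<dots> = ennreal (d n)" using n \<open>finite J\<close> by simp
      also have "d n \<le> \<omega> (exp x * u) / u powr (1 + a)"
      proof -
        have u: "exp (real n - x) \<le> u" "u \<le> exp (real n + 1 - x)" using n by (auto simp: I_def)
        have "u > 0" using u(1) by (rule less_le_trans[rotated]) simp
        define y where "y = ln u"
        have uy: "u = exp y" using \<open>u > 0\<close> by (simp add: y_def)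
        have y: "real n - x \<le> y" "y \<le> real n + 1 - x" using u by (auto simp: uy)
        have "d n \<le> phi \<omega> (x + y) * exp (- (1 + a) * y)"
          unfolding d_def using y \<open>a > 0\<close>
          by (intro mult_mono phi_mono[OF W(1)] phi_nonneg[OF W(1)]) auto
        also have "\<dots> = \<omega> (exp x * u) / u powr (1 + a)"
        proof -
          have "exp (- (1 + a) * y) = 1 / exp ((1 + a) * y)"
            by (metis exp_minus inverse_eq_divide mult_minus_left)
          then show ?thesis by (simp add: phi_def uy exp_add[of x y] powr_def)
        qed
        finally show ?thesis .
      qed
      finally have le: "(\<Sum>m\<in>J. ennreal (d m) * indicator (I m) u)
          \<le> ennreal (\<omega> (exp x * u) / u powr (1 + a))"
        by (simp add: ennreal_leI)
      have "1 \<le> exp (real n - x)" using n by (simp add: J_def)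
      also have "\<dots> \<le> u" using n by (simp add: I_def)
      finally show ?thesis using le by simp
    next
      case False
      then have "(\<Sum>n\<in>J. ennreal (d n) * indicator (I n) u) = 0"
        by (intro sum.neutral) (auto simp: indicator_def)
      then show ?thesis by simp
    qed
    have "ennreal (c * (\<Sum>n\<in>J. phi \<omega> n * exp (- a * \<bar>x - real n\<bar>)))
        = ennreal (\<Sum>n\<in>J. d n * (exp (real n + 1 - x) - exp (real n - x)))"
    proof (rule arg_cong[where f = ennreal], subst sum_distrib_left, rule sum.cong)
      fix n assume "n \<in> J"
      then have "\<bar>x - real n\<bar> = real n - x" by (simp add: J_def)
      moreover have "exp (- (1 + a) * (real n + 1 - x)) * (exp (real n + 1 - x) - exp (real n - x))
          = c * exp (- a * (real n - x))"
        by (simp add: c_def algebra_simps exp_add[symmetric] exp_diff[symmetric])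
      ultimately show "c * (phi \<omega> n * exp (- a * \<bar>x - real n\<bar>))
          = d n * (exp (real n + 1 - x) - exp (real n - x))"
        by (simp add: d_def mult.assoc mult.left_commute)
    qed simp
    also have "\<dots> = (\<Sum>n\<in>J. ennreal (d n) * emeasure lborel (I n))"
      using d0 by (simp add: I_def sum_ennreal[symmetric] ennreal_mult)
    also have "\<dots> = (\<integral>\<^sup>+u. (\<Sum>n\<in>J. ennreal (d n) * indicator (I n) u) \<partial>lborel)"
    proof -
      have I [measurable]: "I n \<in> sets lborel" for n by (simp add: I_def)
      show ?thesis by (subst nn_integral_sum) (simp_all only: nn_integral_cmult_indicator[OF I], measurable)
    qed
    also have "\<dots> \<le> (\<integral>\<^sup>+u\<in>{1..}. ennreal (\<omega> (exp x * u) / u powr (1 + a)) \<partial>lborel)"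
      by (intro nn_integral_mono pt)
    also have "\<dots> \<le> ennreal (C0 * phi \<sigma> x + C0)"
      using C0[of "exp x"] by (simp add: phi_def)
    finally have "c * (\<Sum>n\<in>J. phi \<omega> n * exp (- a * \<bar>x - real n\<bar>)) \<le> C0 * phi \<sigma> x + C0"
      using \<open>C0 > 0\<close> phi_nonneg[OF W(2), of x]
      by (subst (asm) ennreal_le_iff) auto
    then show ?thesis by (simp add: J_def)
  qed
  have left: "(\<Sum>n | n < N \<and> real n < x. phi \<omega> n * exp (- a * \<bar>x - real n\<bar>)) \<le> q * phi \<omega> x" for x N
  proof -
    define K where "K = nat \<lceil>x\<rceil>"
    have "(\<Sum>n | n < N \<and> real n < x. phi \<omega> n * exp (- a * \<bar>x - real n\<bar>))
        \<le> (\<Sum>n | n < N \<and> real n < x. phi \<omega> x * exp (- a) ^ (K - Suc n))"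
    proof (rule sum_mono)
      fix n assume n: "n \<in> {n. n < N \<and> real n < x}"
      then have "Suc n \<le> K" unfolding K_def by simp linarith
      have "real (K - Suc n) \<le> x - real n"
        using n \<open>Suc n \<le> K\<close> unfolding K_def by (simp add: of_nat_diff)
      then have "a * real (K - Suc n) \<le> a * (x - real n)"
        using \<open>a > 0\<close> by (intro mult_left_mono) auto
      then show "phi \<omega> n * exp (- a * \<bar>x - real n\<bar>) \<le> phi \<omega> x * exp (- a) ^ (K - Suc n)"
        using n by (intro mult_mono phi_mono[OF W(1)] phi_nonneg[OF W(1)])
          (auto simp: exp_of_nat_mult[symmetric] mult.commute)
    qed
    also have "\<dots> \<le> (\<Sum>n<K. phi \<omega> x * exp (- a) ^ (K - Suc n))"
      using phi_nonneg[OF W(1), of x] unfolding K_def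
      by (intro sum_mono2) (auto, linarith)
    also have "\<dots> = phi \<omega> x * (\<Sum>n<K. exp (- a) ^ n)"
      by (subst sum_distrib_left[symmetric], subst sum.nat_diff_reindex) simp
    also have "\<dots> \<le> phi \<omega> x * q"
    proof (rule mult_left_mono)
      have "(\<Sum>n<K. exp (- a) ^ n) \<le> (\<Sum>n. exp (- a) ^ n)"
        using \<open>a > 0\<close> by (intro sum_le_suminf summable_geometric) auto
      also have "\<dots> = q" unfolding q_def using \<open>a > 0\<close> by (intro suminf_geometric) auto
      finally show "(\<Sum>n<K. exp (- a) ^ n) \<le> q" .
    qed (rule phi_nonneg[OF W(1)])
    finally show ?thesis by (simp only: mult.commute)
  qed
  define C where "C = C0 / c + q * D"
  have "(\<Sum>n<N. phi \<omega> n * exp (- (1 / r) * \<bar>x - real n\<bar>)) \<le> C * phi \<sigma> x + C" for x N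
  proof -
    have "(\<Sum>n<N. phi \<omega> n * exp (- a * \<bar>x - real n\<bar>)) =
      (\<Sum>n | n < N \<and> real n < x. phi \<omega> n * exp (- a * \<bar>x - real n\<bar>)) +
      (\<Sum>n | n < N \<and> x \<le> real n. phi \<omega> n * exp (- a * \<bar>x - real n\<bar>))"
      by (subst sum.union_disjoint[symmetric]) (auto intro!: sum.cong)
    also have "\<dots> \<le> q * phi \<omega> x + (C0 * phi \<sigma> x + C0) / c"
      using left right[of x N] \<open>c > 0\<close>
      by (intro add_mono) (simp_all only: pos_le_divide_eq mult.commute[of _ c])
    also have "q * phi \<omega> x \<le> q * (D * phi \<sigma> x + D)"
      using D(2)[of x] \<open>q > 0\<close> by (intro mult_left_mono) auto
    also have "q * (D * phi \<sigma> x + D) + (C0 * phi \<sigma> x + C0) / c = C * phi \<sigma> x + C"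
      using \<open>c > 0\<close> by (simp add: C_def field_simps)
    finally show ?thesis by (simp add: a_def)
  qed
  moreover have "C > 0"
    using \<open>C0 > 0\<close> \<open>c > 0\<close> \<open>q > 0\<close> D by (simp add: C_def add_pos_pos)
  ultimately show thesis using that by blast
qed

lemma open_sector: "open (sector r)"
proof -
  have "sector r = Im -` {- (r * pi / 2)<..<r * pi / 2}" by (auto simp: sector_def)
  then show ?thesis by (simp add: continuous_open_vimage continuous_on_Im open_vimage)
qed

lemma convex_sector: "convex (sector r)"
proof -
  have "sector r = {w. Im w < r * pi / 2} \<inter> {w. Im w > - (r * pi / 2)}"
    by (auto simp: sector_def)
  then show ?thesis
    by (simp only: convex_Int convex_halfspace_Im_lt convex_halfspace_Im_gt)
qed

lemma of_real_in_sector: "r > 0 \<Longrightarrow> complex_of_real x \<in> sector r"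
  by (simp add: sector_def)

text \<open>The substitute for the Poisson extension of the weight: \<open>exp (- H)\<close> decays at infinity in
  the sector of opening \<open>r\<close> at least as \<open>exp (- c \<omega>)\<close>, whereas on the positive real line it is
  not smaller than \<open>exp (- C \<sigma> - C)\<close>.\<close>

lemma holomorphic_weight:
  assumes W: "\<omega> \<in> class_W" "\<sigma> \<in> class_W" and O: "\<omega> \<in> O[at_top](\<sigma>)"
    and "r > 0" and g: "gamma_condition \<sigma> \<omega> r"
  obtains H c C where "H holomorphic_on sector r" "c > 0" "C > 0"
    "\<And>w. w \<in> sector r \<Longrightarrow> c * phi \<omega> (Re w) \<le> Re (H w)"
    "\<And>x. H (of_real x) \<in> \<real>" "\<And>x. Re (H (of_real x)) \<le> C * phi \<sigma> x + C"
proof -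
  obtain C where "C > 0" and C:
    "\<And>x N. (\<Sum>n<N. phi \<omega> (real n) * exp (- (1 / r) * \<bar>x - real n\<bar>)) \<le> C * phi \<sigma> x + C"
    using gamma_condition_sum[OF assms] by blast
  define a where "a = 1 / r"
  have "a > 0" using \<open>r > 0\<close> by (simp add: a_def)
  define M where "M x n = phi \<omega> (real n) * exp (- a * \<bar>x - real n\<bar>)" for x n
  have M0: "M x n \<ge> 0" for x n by (simp add: M_def phi_nonneg[OF W(1)])
  have sumM: "summable (M x)" for x
  proof (rule bounded_imp_summable[OF M0])
    fix N show "(\<Sum>n\<le>N. M x n) \<le> C * phi \<sigma> x + C"
      using C[of x "Suc N"] unfolding lessThan_Suc_atMost by (simp add: M_def a_def)
  qed
  define T where "T n w = of_real (phi \<omega> (real n)) * kern (of_real a * (w - of_nat n))" for n w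
  have Im: "\<bar>Im (of_real a * (w - of_nat n))\<bar> \<le> pi / 2" if "w \<in> sector r" for w n
  proof -
    have "a * \<bar>Im w\<bar> \<le> a * (r * pi / 2)"
      using that \<open>a > 0\<close> by (intro mult_left_mono) (auto simp: sector_def)
    then show ?thesis using \<open>r > 0\<close> \<open>a > 0\<close> by (simp add: abs_mult a_def)
  qed
  have TM: "norm (T n w) \<le> M (Re w) n" if "w \<in> sector r" for n w
  proof -
    have "norm (kern (of_real a * (w - of_nat n))) \<le> exp (- a * \<bar>Re w - real n\<bar>)"
      using norm_kern_le[OF Im[OF that, of n]] \<open>a > 0\<close> by (simp add: abs_mult)
    then show ?thesis unfolding T_def M_def norm_mult
      using phi_nonneg[OF W(1)] by (intro mult_mono) auto
  qed
  define H where "H w = (\<Sum>n. T n w)" for w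
  have sumT: "summable (\<lambda>n. norm (T n w))" if "w \<in> sector r" for w
    by (rule summable_comparison_test'[OF sumM[of "Re w"]]) (use TM[OF that] in auto)
  have Tsums: "(\<lambda>n. T n w) sums H w" if "w \<in> sector r" for w
    unfolding H_def using summable_norm_cancel[OF sumT[OF that]] by (rule summable_sums)
  have ReT: "Re (T n w) \<ge> 0" if "w \<in> sector r" for n w
    using Re_kern_nonneg[OF Im[OF that]] phi_nonneg[OF W(1)] by (simp add: T_def)
  have "H holomorphic_on sector r"
  proof (rule holomorphic_uniform_sequence[OF open_sector, of "\<lambda>N w. \<Sum>n<N. T n w"])
    show "(\<lambda>w. \<Sum>n<N. T n w) holomorphic_on sector r" for N
      unfolding T_def kern_def
      using one_plus_exp_nonzero[OF Im] by (intro holomorphic_intros) auto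
  next
    fix w assume w: "w \<in> sector r"
    obtain d where d: "d > 0" "cball w d \<subseteq> sector r"
      using open_sector[of r] w by (auto simp: open_contains_cball)
    have "uniform_limit (cball w d) (\<lambda>N w. \<Sum>n<N. T n w) H sequentially"
      unfolding H_def
    proof (rule Weierstrass_m_test)
      show "summable (\<lambda>n. exp (a * d) * M (Re w) n)"
        by (intro summable_mult sumM)
      fix n v assume v: "v \<in> cball w d"
      have "norm (T n v) \<le> M (Re v) n" using v d by (intro TM) auto
      also have "\<dots> \<le> phi \<omega> (real n) * exp (a * d - a * \<bar>Re w - real n\<bar>)"
      proof -
        have "\<bar>Re w - Re v\<bar> \<le> d"
          using v abs_Re_le_cmod[of "w - v"] by (simp add: dist_norm)
        then have "\<bar>Re w - real n\<bar> - d \<le> \<bar>Re v - real n\<bar>" by linarith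
        then have "a * (\<bar>Re w - real n\<bar> - d) \<le> a * \<bar>Re v - real n\<bar>"
          using \<open>a > 0\<close> by (intro mult_left_mono) auto
        then show ?thesis unfolding M_def using phi_nonneg[OF W(1)]
          by (intro mult_left_mono) (auto simp: algebra_simps)
      qed
      also have "\<dots> = exp (a * d) * M (Re w) n"
        by (simp add: M_def exp_add[symmetric] exp_diff exp_minus field_simps)
      finally show "norm (T n v) \<le> exp (a * d) * M (Re w) n" .
    qed
    with d show "\<exists>d>0. cball w d \<subseteq> sector r \<and>
        uniform_limit (cball w d) (\<lambda>N w. \<Sum>n<N. T n w) H sequentially" by blast
  qed
  moreover define c where "c = 2 * exp (- 2 * a) / 2 ^ 4"
  have "c > 0" by (simp add: c_def)
  moreover have "c * phi \<omega> (Re w) \<le> Re (H w)" if w: "w \<in> sector r" for w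
  proof -
    have sums: "(\<lambda>n. Re (T n w)) sums Re (H w)" by (rule sums_Re[OF Tsums[OF w]])
    show ?thesis
    proof (cases "Re w \<ge> 0")
      case True
      define n where "n = nat \<lceil>Re w\<rceil>"
      have n: "Re w \<le> real n" "real n \<le> Re w + 1" using True by (auto simp: n_def)
      define v where "v = of_real a * (w - of_nat n)"
      have Rev: "Re v \<le> 0" "Re v \<ge> - a"
      proof -
        show "Re v \<le> 0" using n \<open>a > 0\<close> by (simp add: v_def mult_nonneg_nonpos)
        have "a * (Re w - real n) \<ge> a * (- 1)" using n \<open>a > 0\<close> by (intro mult_left_mono) auto
        then show "Re v \<ge> - a" by (simp add: v_def)
      qed
      have "c \<le> 2 * exp (2 * Re v) / (1 + exp (Re v)) ^ 4"
        unfolding c_def using Rev add_pos_pos[OF zero_less_one exp_gt_zero[of "Re v"]]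
        by (intro frac_le power_mono zero_less_power) auto
      also have "\<dots> \<le> Re (kern v)" unfolding v_def by (rule Re_kern_ge[OF Im[OF w]])
      finally have "c \<le> Re (kern v)" .
      then have "c * phi \<omega> (Re w) \<le> Re (kern v) * phi \<omega> (real n)"
        using \<open>c > 0\<close> n by (intro mult_mono phi_mono[OF W(1)] phi_nonneg[OF W(1)]) auto
      also have "\<dots> = (\<Sum>i\<in>{n}. Re (T i w))" by (simp add: T_def v_def mult.commute)
      also have "\<dots> \<le> (\<Sum>i. Re (T i w))"
        using ReT[OF w] sums by (intro sum_le_suminf) (auto simp: sums_iff)
      finally show ?thesis using sums by (simp add: sums_iff)
    next
      case False
      then have "phi \<omega> (Re w) = 0" by (intro phi_eq_0[OF W(1)]) auto
      moreover have "Re (H w) \<ge> 0"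
        using suminf_nonneg[of "\<lambda>n. Re (T n w)"] sums ReT[OF w] by (auto simp: sums_iff)
      ultimately show ?thesis by simp
    qed
  qed
  moreover have "H (of_real x) \<in> \<real>" for x
  proof -
    have "kern (of_real y) \<in> \<real>" for y :: real
      by (auto simp: kern_def exp_of_real intro!: Reals_divide Reals_power Reals_add)
    then have "T n (of_real x) \<in> \<real>" for n
      by (metis (no_types, lifting) Reals_mult Reals_of_real T_def of_real_diff of_real_mult of_real_of_nat_eq)
    then have "(\<lambda>n. Im (T n (of_real x))) = (\<lambda>n. 0)" by (auto simp: complex_is_Real_iff)
    then have "Im (H (of_real x)) = 0"
      using sums_Im[OF Tsums[OF of_real_in_sector[OF \<open>r > 0\<close>, of x]]] by (simp add: sums_iff)
    then show ?thesis by (simp add: complex_is_Real_iff)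
  qed
  moreover have "Re (H (of_real x)) \<le> C * phi \<sigma> x + C" for x
  proof -
    have xs: "of_real x \<in> sector r" by (rule of_real_in_sector[OF \<open>r > 0\<close>])
    have "Re (H (of_real x)) \<le> norm (H (of_real x))" by (rule complex_Re_le_cmod)
    also have "\<dots> \<le> (\<Sum>n. norm (T n (of_real x)))"
      unfolding H_def by (rule summable_norm[OF sumT[OF xs]])
    also have "\<dots> \<le> (\<Sum>n. M x n)"
      using TM[OF xs] by (intro suminf_le sumT[OF xs] sumM) auto
    also have "\<dots> \<le> C * phi \<sigma> x + C"
      using C[of x] by (intro suminf_le_const[OF sumM]) (auto simp: M_def a_def)
    finally show ?thesis .
  qed
  ultimately show thesis using that \<open>C > 0\<close> by blast
qed

section \<open>Primitives on strips\<close>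

text \<open>The function \<open>2 arctan (exp t)\<close> is a bounded increasing primitive of \<open>1 / cosh t\<close>, which
  dominates \<open>exp (- \<bar>t\<bar>)\<close>.\<close>

lemma horizontal_increment:
  assumes P: "\<And>u. u \<in> sector r \<Longrightarrow> (P has_field_derivative F u) (at u)"
    and v: "v \<in> sector r" and "a \<le> b"
    and le: "\<And>x. a < x \<Longrightarrow> x < b \<Longrightarrow> norm (F (v + of_real x)) \<le> A * exp (- \<bar>Re v + x\<bar>)"
  shows "norm (P (v + of_real b) - P (v + of_real a))
           \<le> A * (2 * arctan (exp (Re v + b))) - A * (2 * arctan (exp (Re v + a)))"
proof (cases "a = b")
  case False
  then have "a < b" using \<open>a \<le> b\<close> by simp
  have vx: "v + of_real x \<in> sector r" for x using v by (simp add: sector_def)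
  have d: "((\<lambda>x. P (v + of_real x)) has_vector_derivative F (v + of_real x)) (at x)" for x
  proof -
    have "((\<lambda>x. v + complex_of_real x) has_vector_derivative 1) (at x)"
      by (auto intro!: derivative_eq_intros)
    from field_vector_diff_chain_at[OF this P[OF vx]] show ?thesis
      by (simp add: o_def)
  qed
  define g' where "g' x = A * (2 * (exp (Re v + x) / (1 + exp (Re v + x) ^ 2)))" for x
  have g: "((\<lambda>x. A * (2 * arctan (exp (Re v + x)))) has_vector_derivative g' x) (at x)" for x
    unfolding has_real_derivative_iff_has_vector_derivative[symmetric] g'_def
    by (auto intro!: derivative_eq_intros simp: divide_inverse)
  have key: "exp (- \<bar>t\<bar>) \<le> 2 * (exp t / (1 + exp t ^ 2))" for t :: real
  proof (cases "t \<ge> 0")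
    case True
    then have "exp t ^ 2 \<ge> 1" by simp
    then have "exp (- t) * (1 + exp t ^ 2) \<le> exp (- t) * (2 * exp t ^ 2)"
      by (intro mult_left_mono) auto
    also have "\<dots> = 2 * exp t" by (simp add: power2_eq_square exp_minus)
    finally show ?thesis using True by (simp add: field_simps add_pos_nonneg)
  next
    case False
    then have "exp t ^ 2 \<le> 1" by (simp add: exp_double[symmetric])
    then have "exp t * (1 + exp t ^ 2) \<le> exp t * 2"
      by (intro mult_left_mono) auto
    then show ?thesis using False by (simp add: field_simps add_pos_nonneg)
  qed
  show ?thesis
  proof (rule differentiable_bound_general[OF \<open>a < b\<close> _ _ d g])
    show "continuous_on {a..b} (\<lambda>x. P (v + of_real x))"
      using d by (meson continuous_at_imp_continuous_on has_vector_derivative_continuous)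
    show "continuous_on {a..b} (\<lambda>x. A * (2 * arctan (exp (Re v + x))))"
      by (intro continuous_intros)
    fix x assume x: "a < x" "x < b"
    have "A \<ge> 0" using order_trans[OF norm_ge_zero le[OF x]] by (simp add: zero_le_mult_iff)
    have "norm (F (v + of_real x)) \<le> A * exp (- \<bar>Re v + x\<bar>)" by (rule le[OF x])
    also have "\<dots> \<le> g' x" unfolding g'_def by (intro mult_left_mono key \<open>A \<ge> 0\<close>)
    finally show "norm (F (v + of_real x)) \<le> g' x" .
  qed
qed simp

lemma convergent_comparison:
  fixes f :: "nat \<Rightarrow> complex" and h :: "nat \<Rightarrow> real"
  assumes "convergent h" and le: "\<And>m n. m \<le> n \<Longrightarrow> norm (f n - f m) \<le> Q * \<bar>h n - h m\<bar>" and "Q \<ge> 0"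
  shows "convergent f"
proof -
  have "Cauchy h" using assms(1) by (simp add: Cauchy_convergent_iff)
  have "Cauchy f"
  proof (rule metric_CauchyI)
    fix e :: real assume "e > 0"
    then have "e / (Q + 1) > 0" using \<open>Q \<ge> 0\<close> by simp
    then obtain M where M: "\<And>m n. m \<ge> M \<Longrightarrow> n \<ge> M \<Longrightarrow> dist (h m) (h n) < e / (Q + 1)"
      using \<open>Cauchy h\<close> unfolding Cauchy_def by meson
    have *: "norm (f n - f m) < e" if "m \<ge> M" "m \<le> n" for m n
    proof -
      have "norm (f n - f m) \<le> Q * \<bar>h n - h m\<bar>" by (rule le[OF that(2)])
      also have "\<dots> \<le> (Q + 1) * \<bar>h n - h m\<bar>" by (intro mult_right_mono) auto
      also have "\<dots> < (Q + 1) * (e / (Q + 1))"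
        using M[of n m] that \<open>Q \<ge> 0\<close> by (intro mult_strict_left_mono) (auto simp: dist_real_def)
      finally show ?thesis using \<open>Q \<ge> 0\<close> by simp
    qed
    have "dist (f m) (f n) < e" if "m \<ge> M" "n \<ge> M" for m n
      using *[of m n] *[of n m] that by (cases "m \<le> n") (auto simp: dist_norm norm_minus_commute)
    then show "\<exists>M. \<forall>m\<ge>M. \<forall>n\<ge>M. dist (f m) (f n) < e" by blast
  qed
  then show ?thesis by (simp add: Cauchy_convergent_iff)
qed

text \<open>A holomorphic function that decays at both ends of the strip has a primitive \<open>\<Psi>\<close> that
  vanishes at the left end and has a limit \<open>m\<close> at the right end, independently of the
  horizontal line on which the limit is taken. For \<open>F v = E (exp v) exp (p v)\<close> this says that the Mellin
  transform of \<open>E\<close> can be computed along any ray, and \<open>\<Psi>\<close> is the truncated transform.\<close>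

lemma decaying_primitive:
  assumes "r > 0" and hol: "F holomorphic_on sector r"
    and Q: "\<And>v. v \<in> sector r \<Longrightarrow> norm (F v) \<le> Q * exp (- \<bar>Re v\<bar>)"
  obtains \<Psi> :: "complex \<Rightarrow> complex" and m :: complex where "\<Psi> holomorphic_on sector r"
    and "\<And>v A. v \<in> sector r \<Longrightarrow>
      (\<And>x. x < 0 \<Longrightarrow> norm (F (v + of_real x)) \<le> A * exp (- \<bar>Re v + x\<bar>)) \<Longrightarrow> norm (\<Psi> v) \<le> pi * A"
    and "\<And>v A. v \<in> sector r \<Longrightarrow>
      (\<And>x. x > 0 \<Longrightarrow> norm (F (v + of_real x)) \<le> A * exp (- \<bar>Re v + x\<bar>)) \<Longrightarrow> norm (m - \<Psi> v) \<le> pi * A"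
    and "\<And>y c. (\<And>x. Re (F (of_real x)) \<ge> 0) \<Longrightarrow>
      (\<And>x. y - 1 \<le> x \<Longrightarrow> x \<le> y \<Longrightarrow> Re (F (of_real x)) \<ge> c) \<Longrightarrow> Re m \<ge> c"
proof -
  obtain P where P': "\<And>u. u \<in> sector r \<Longrightarrow> (P has_field_derivative F u) (at u within sector r)"
    using holomorphic_convex_primitive'[OF convex_sector open_sector hol] by blast
  then have P: "(P has_field_derivative F u) (at u)" if "u \<in> sector r" for u
    using that open_sector by (metis at_within_open)
  have rs: "of_real x \<in> sector r" for x by (rule of_real_in_sector[OF \<open>r > 0\<close>])
  have vx: "v + of_real x \<in> sector r" if "v \<in> sector r" for v x
    using that by (simp add: sector_def)
  have "Q \<ge> 0" using order_trans[OF norm_ge_zero Q[OF rs[of 0]]] by simp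
  have incr: "norm (P (v + of_real b) - P (v + of_real a))
      \<le> Q * (2 * arctan (exp (Re v + b))) - Q * (2 * arctan (exp (Re v + a)))"
    if "v \<in> sector r" "a \<le> b" for v a b
    using that Q[OF vx] by (intro horizontal_increment[OF P]) auto
  have conv1: "convergent (\<lambda>n. P (of_real (real n)))"
  proof (rule convergent_comparison[OF _ _ \<open>Q \<ge> 0\<close>])
    have "(\<lambda>n. 2 * arctan (exp (real n))) \<longlonglongrightarrow> pi" by real_asymp
    then show "convergent (\<lambda>n. 2 * arctan (exp (real n)))" by (rule convergentI)
    fix m n :: nat assume "m \<le> n"
    have "norm (P (of_real n) - P (of_real m)) \<le> Q * (2 * arctan (exp n) - 2 * arctan (exp m))"
      using incr[of 0 m n] \<open>m \<le> n\<close> rs[of 0] by (simp add: right_diff_distrib)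
    also have "\<dots> \<le> Q * \<bar>2 * arctan (exp n) - 2 * arctan (exp m)\<bar>"
      using \<open>Q \<ge> 0\<close> by (intro mult_left_mono) auto
    finally show "norm (P (of_real n) - P (of_real m)) \<le> Q * \<bar>2 * arctan (exp n) - 2 * arctan (exp m)\<bar>" .
  qed
  have conv2: "convergent (\<lambda>n. P (of_real (- real n)))"
  proof (rule convergent_comparison[OF _ _ \<open>Q \<ge> 0\<close>])
    have "(\<lambda>n. 2 * arctan (exp (- real n))) \<longlonglongrightarrow> 0" by real_asymp
    then show "convergent (\<lambda>n. 2 * arctan (exp (- real n)))" by (rule convergentI)
    fix m n :: nat assume "m \<le> n"
    have "norm (P (of_real (- real m)) - P (of_real (- real n)))
        \<le> Q * (2 * arctan (exp (- real m)) - 2 * arctan (exp (- real n)))"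
      using incr[of 0 "- real n" "- real m"] \<open>m \<le> n\<close> rs[of 0] by (simp add: right_diff_distrib)
    also have "\<dots> \<le> Q * \<bar>2 * arctan (exp (- real m)) - 2 * arctan (exp (- real n))\<bar>"
      using \<open>Q \<ge> 0\<close> by (intro mult_left_mono) auto
    finally show "norm (P (of_real (- real n)) - P (of_real (- real m)))
        \<le> Q * \<bar>2 * arctan (exp (- real n)) - 2 * arctan (exp (- real m))\<bar>"
      by (simp only: norm_minus_commute abs_minus_commute)
  qed
  obtain l1 l2 where l1: "(\<lambda>n. P (of_real (real n))) \<longlonglongrightarrow> l1"
    and l2: "(\<lambda>n. P (of_real (- real n))) \<longlonglongrightarrow> l2"
    using conv1 conv2 by (auto simp: convergent_def)
  \<comment> \<open>The limit does not depend on the horizontal line: on the segment from \<open>s\<close> to \<open>v + s\<close> the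
    derivative \<open>F\<close> is exponentially small in \<open>s\<close>.\<close>
  have shift: "norm (P (v + of_real s) - P (of_real s)) \<le> Q * exp (\<bar>Re v\<bar> - \<bar>s\<bar>) * norm v"
    if v: "v \<in> sector r" for v s
  proof -
    have seg: "closed_segment (of_real s) (v + of_real s) \<subseteq> sector r"
      using rs[of s] vx[OF v, of s] convex_sector by (simp add: closed_segment_subset)
    have bd: "norm (F u) \<le> Q * exp (\<bar>Re v\<bar> - \<bar>s\<bar>)"
      if u: "u \<in> closed_segment (of_real s) (v + of_real s)" for u
    proof -
      obtain t where t: "0 \<le> t" "t \<le> 1" "u = (1 - t) *\<^sub>R of_real s + t *\<^sub>R (v + of_real s)"
        using u by (auto simp: in_segment)
      then have Reu: "Re u = s + t * Re v" by (simp add: algebra_simps)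
      have "\<bar>t * Re v\<bar> \<le> \<bar>Re v\<bar>" using t by (simp add: abs_mult mult_left_le_one_le)
      then have "- \<bar>Re u\<bar> \<le> \<bar>Re v\<bar> - \<bar>s\<bar>" unfolding Reu by linarith
      then have "Q * exp (- \<bar>Re u\<bar>) \<le> Q * exp (\<bar>Re v\<bar> - \<bar>s\<bar>)"
        using \<open>Q \<ge> 0\<close> by (intro mult_left_mono) auto
      then show ?thesis using Q[of u] u seg by auto
    qed
    have "norm (P (v + of_real s) - P (of_real s)) \<le>
        Q * exp (\<bar>Re v\<bar> - \<bar>s\<bar>) * norm ((v + of_real s) - of_real s)"
    proof (rule field_differentiable_bound[OF convex_closed_segment _ bd])
      show "(P has_field_derivative F u)
          (at u within closed_segment (of_real s) (v + of_real s))"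
        if "u \<in> closed_segment (of_real s) (v + of_real s)" for u
        using that seg P by (meson has_field_derivative_at_within subsetD)
    qed auto
    then show ?thesis by simp
  qed
  have lim_any: "(\<lambda>n. P (v + of_real (s n))) \<longlonglongrightarrow> l"
    if v: "v \<in> sector r" and l: "(\<lambda>n. P (of_real (s n))) \<longlonglongrightarrow> l" and s: "\<And>n. \<bar>s n\<bar> = real n"
    for v s l
  proof -
    have "(\<lambda>n. P (v + of_real (s n)) - P (of_real (s n))) \<longlonglongrightarrow> 0"
    proof (rule Lim_null_comparison)
      show "\<forall>\<^sub>F n in sequentially. norm (P (v + of_real (s n)) - P (of_real (s n)))
          \<le> Q * exp (\<bar>Re v\<bar> - real n) * norm v"
        using shift[OF v] s by (metis (mono_tags, lifting) always_eventually)
      show "(\<lambda>n. Q * exp (\<bar>Re v\<bar> - real n) * norm v) \<longlonglongrightarrow> 0" by real_asymp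
    qed
    from tendsto_add[OF this l] show ?thesis by simp
  qed
  define \<Psi> where "\<Psi> v = P v - l2" for v
  define m where "m = l1 - l2"
  have left: "(\<lambda>n. \<Psi> (v + of_real (- real n))) \<longlonglongrightarrow> 0" if "v \<in> sector r" for v
    unfolding \<Psi>_def using tendsto_diff[OF lim_any[OF that l2] tendsto_const[of l2]] by simp
  have right: "(\<lambda>n. \<Psi> (v + of_real (real n))) \<longlonglongrightarrow> m" if "v \<in> sector r" for v
    unfolding \<Psi>_def m_def using tendsto_diff[OF lim_any[OF that l1] tendsto_const[of l2]] by simp
  have \<Psi>': "(\<Psi> has_field_derivative F u) (at u)" if "u \<in> sector r" for u
    unfolding \<Psi>_def using P[OF that] by (auto intro!: derivative_eq_intros)
  have arctan_bd: "A * (2 * arctan s) - A * (2 * arctan t) \<le> pi * A" if "A \<ge> 0" "t \<ge> 0" for A s t :: real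
  proof -
    have "2 * arctan s - 2 * arctan t \<le> pi"
      using arctan_ubound[of s] zero_le_arctan_iff[of t] \<open>t \<ge> 0\<close> by linarith
    then have "A * (2 * arctan s - 2 * arctan t) \<le> A * pi" using \<open>A \<ge> 0\<close> by (rule mult_left_mono)
    then show ?thesis by (simp add: right_diff_distrib mult.commute)
  qed
  have "\<Psi> holomorphic_on sector r"
    using \<Psi>' open_sector by (auto simp: holomorphic_on_open)
  moreover have "norm (\<Psi> v) \<le> pi * A"
    if v: "v \<in> sector r"
      and A: "\<And>x. x < 0 \<Longrightarrow> norm (F (v + of_real x)) \<le> A * exp (- \<bar>Re v + x\<bar>)" for v A
  proof -
    have "A \<ge> 0" using order_trans[OF norm_ge_zero A[of "- 1"]] by (simp add: zero_le_mult_iff)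
    have "norm (\<Psi> v - \<Psi> (v + of_real (- real n))) \<le> pi * A" for n
      using horizontal_increment[OF \<Psi>' v, of "- real n" 0 A] A
        arctan_bd[OF \<open>A \<ge> 0\<close>, of "exp (Re v - real n)" "exp (Re v)"] by force
    moreover have "(\<lambda>n. norm (\<Psi> v - \<Psi> (v + of_real (- real n)))) \<longlonglongrightarrow> norm (\<Psi> v - 0)"
      by (intro tendsto_intros left v)
    ultimately show ?thesis by (intro LIMSEQ_le_const2[of _ "norm (\<Psi> v)"]) auto
  qed
  moreover have "norm (m - \<Psi> v) \<le> pi * A"
    if v: "v \<in> sector r"
      and A: "\<And>x. x > 0 \<Longrightarrow> norm (F (v + of_real x)) \<le> A * exp (- \<bar>Re v + x\<bar>)" for v A
  proof -
    have "A \<ge> 0" using order_trans[OF norm_ge_zero A[of 1]] by (simp add: zero_le_mult_iff)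
    have "norm (\<Psi> (v + of_real (real n)) - \<Psi> v) \<le> pi * A" for n
      using horizontal_increment[OF \<Psi>' v, of 0 "real n" A] A
        arctan_bd[OF \<open>A \<ge> 0\<close>, of "exp (Re v)" "exp (Re v + real n)"] by force
    moreover have "(\<lambda>n. norm (\<Psi> (v + of_real (real n)) - \<Psi> v)) \<longlonglongrightarrow> norm (m - \<Psi> v)"
      by (intro tendsto_intros right v)
    ultimately show ?thesis by (intro LIMSEQ_le_const2[of _ "norm (m - \<Psi> v)"]) auto
  qed
  moreover have "Re m \<ge> c"
    if F0: "\<And>x. Re (F (of_real x)) \<ge> 0"
      and c: "\<And>x. y - 1 \<le> x \<Longrightarrow> x \<le> y \<Longrightarrow> Re (F (of_real x)) \<ge> c" for y c
  proof -
    define R where "R x = Re (\<Psi> (of_real x))" for x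
    have R': "(R has_real_derivative Re (F (of_real x))) (at x)" for x
    proof -
      have "((\<lambda>x. \<Psi> (of_real x)) has_vector_derivative F (of_real x)) (at x)"
        using has_vector_derivative_real_field[OF \<Psi>'[OF rs[of x]]] by simp
      then have "((\<lambda>x. Re (\<Psi> (of_real x))) has_vector_derivative Re (F (of_real x))) (at x)"
        by (rule bounded_linear.has_vector_derivative[OF bounded_linear_Re])
      then show ?thesis
        by (simp add: R_def[abs_def] has_real_derivative_iff_has_vector_derivative)
    qed
    have mono: "R x \<le> R x'" if "x \<le> x'" for x x'
      by (rule DERIV_nonneg_imp_nondecreasing[OF that]) (use R' F0 in blast)
    obtain z where "y - 1 < z" "z < y" "R y - R (y - 1) = (y - (y - 1)) * Re (F (of_real z))"
      using MVT2[of "y - 1" y R "\<lambda>x. Re (F (of_real x))"] R' by auto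
    then have step: "R y - R (y - 1) \<ge> c" using c[of z] by simp
    have "(\<lambda>n. R (- real n)) \<longlonglongrightarrow> 0"
      unfolding R_def using tendsto_Re[OF left[OF rs[of 0]]] by simp
    then have "0 \<le> R (y - 1)"
    proof (rule LIMSEQ_le_const2)
      have "R (- real n) \<le> R (y - 1)" if "n \<ge> nat \<lceil>1 - y\<rceil>" for n
        using that by (intro mono) linarith
      then show "\<exists>N. \<forall>n\<ge>N. R (- real n) \<le> R (y - 1)" by blast
    qed
    moreover have "(\<lambda>n. R (real n)) \<longlonglongrightarrow> Re m"
      unfolding R_def using tendsto_Re[OF right[OF rs[of 0]]] by simp
    then have "R y \<le> Re m"
    proof (rule LIMSEQ_le_const)
      have "R y \<le> R (real n)" if "n \<ge> nat \<lceil>y\<rceil>" for n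
        using that by (intro mono) linarith
      then show "\<exists>N. \<forall>n\<ge>N. R y \<le> R (real n)" by blast
    qed
    ultimately show ?thesis using step by linarith
  qed
  ultimately show thesis by (rule that)
qed

section \<open>The truncated Laplace transform\<close>

text \<open>The family \<open>\<Psi> p\<close>, \<open>m p\<close> of truncated and complete moments of the flat function
  \<open>exp (- s H)\<close>. The quotient \<open>\<Psi> p / m p\<close> interpolates between \<open>0\<close> at the left end
  and \<open>1\<close> at the right end of the strip.\<close>

lemma truncated_moments:
  assumes "r > 0" and hol: "H holomorphic_on sector r"
    and A: "\<And>N v. v \<in> sector r \<Longrightarrow>
      exp (real (Suc N) * Re v + \<bar>Re v\<bar> - s * Re (H v)) \<le> A N"
    and real: "\<And>x. H (of_real x) \<in> \<real>"
    and low: "\<And>x. s * Re (H (of_real x)) \<le> G x"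
    and G: "mono G"
  obtains \<Psi> :: "nat \<Rightarrow> complex \<Rightarrow> complex" and m :: "nat \<Rightarrow> complex"
  where "\<And>p. \<Psi> p holomorphic_on sector r"
    and "\<And>p N v. v \<in> sector r \<Longrightarrow> N \<le> p \<Longrightarrow>
      norm (\<Psi> p v) \<le> pi * A N * exp ((real p - real N) * Re v)"
    and "\<And>p N v. v \<in> sector r \<Longrightarrow> p \<le> N \<Longrightarrow>
      norm (m p - \<Psi> p v) \<le> pi * A N * exp ((real p - real N) * Re v)"
    and "\<And>p y. exp (real (Suc p) * (y - 1) - G y) \<le> Re (m p)"
proof -
  define F where "F p v = exp (of_nat (Suc p) * v - of_real s * H v)" for p v
  have normF: "norm (F p v) = exp (real (Suc p) * Re v - s * Re (H v))" for p v
    by (simp add: F_def)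
  have F_le: "norm (F p v) \<le> exp ((real p - real N) * Re v) * (A N * exp (- \<bar>Re v\<bar>))"
    if "v \<in> sector r" for p N v
  proof -
    have "norm (F p v) = exp ((real p - real N) * Re v) *
        (exp (real (Suc N) * Re v + \<bar>Re v\<bar> - s * Re (H v)) * exp (- \<bar>Re v\<bar>))"
      unfolding normF exp_add[symmetric] by (simp add: algebra_simps)
    also have "\<dots> \<le> exp ((real p - real N) * Re v) * (A N * exp (- \<bar>Re v\<bar>))"
      by (intro mult_left_mono mult_right_mono A that) auto
    finally show ?thesis .
  qed
  have vx: "v + of_real x \<in> sector r" if "v \<in> sector r" for v x
    using that by (simp add: sector_def)
  have A0: "A N \<ge> 0" for N
    using order_trans[OF exp_ge_zero A[OF of_real_in_sector[OF \<open>r > 0\<close>]]] .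
  have "\<exists>\<Psi> m. \<Psi> holomorphic_on sector r \<and>
      (\<forall>N\<le>p. \<forall>v\<in>sector r. norm (\<Psi> v) \<le> pi * A N * exp ((real p - real N) * Re v)) \<and>
      (\<forall>N\<ge>p. \<forall>v\<in>sector r. norm (m - \<Psi> v) \<le> pi * A N * exp ((real p - real N) * Re v)) \<and>
      (\<forall>y. exp (real (Suc p) * (y - 1) - G y) \<le> Re m)" for p
  proof (rule decaying_primitive[OF \<open>r > 0\<close>])
    show "F p holomorphic_on sector r"
      unfolding F_def by (intro holomorphic_intros hol)
    show "norm (F p v) \<le> A p * exp (- \<bar>Re v\<bar>)" if "v \<in> sector r" for v
      using F_le[OF that, of p p] by simp
  next
    fix \<Psi> :: "complex \<Rightarrow> complex" and m :: complex
    assume h: "\<Psi> holomorphic_on sector r"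
      and l: "\<And>v A. v \<in> sector r \<Longrightarrow>
        (\<And>x. x < 0 \<Longrightarrow> norm (F p (v + of_real x)) \<le> A * exp (- \<bar>Re v + x\<bar>)) \<Longrightarrow> norm (\<Psi> v) \<le> pi * A"
      and r: "\<And>v A. v \<in> sector r \<Longrightarrow>
        (\<And>x. x > 0 \<Longrightarrow> norm (F p (v + of_real x)) \<le> A * exp (- \<bar>Re v + x\<bar>)) \<Longrightarrow> norm (m - \<Psi> v) \<le> pi * A"
      and m: "\<And>y c. (\<And>x. Re (F p (of_real x)) \<ge> 0) \<Longrightarrow>
        (\<And>x. y - 1 \<le> x \<Longrightarrow> x \<le> y \<Longrightarrow> Re (F p (of_real x)) \<ge> c) \<Longrightarrow> Re m \<ge> c"
    have tr: "norm (F p (v + of_real x)) \<le> A N * exp ((real p - real N) * Re v) * exp (- \<bar>Re v + x\<bar>)"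
      if v: "v \<in> sector r" and x: "(real p - real N) * x \<le> 0" for N v x
    proof -
      have "norm (F p (v + of_real x))
          \<le> exp ((real p - real N) * (Re v + x)) * (A N * exp (- \<bar>Re v + x\<bar>))"
        using F_le[OF vx[OF v], of p x N] by simp
      also have "\<dots> \<le> exp ((real p - real N) * Re v) * (A N * exp (- \<bar>Re v + x\<bar>))"
        using x A0 by (intro mult_right_mono) (auto simp: distrib_left)
      finally show ?thesis by (simp only: ac_simps)
    qed
    have "norm (\<Psi> v) \<le> pi * A N * exp ((real p - real N) * Re v)"
      if "N \<le> p" "v \<in> sector r" for N v
      using l[OF that(2) tr[OF that(2)]] that(1) by (simp add: mult_nonneg_nonpos mult.assoc)
    moreover have "norm (m - \<Psi> v) \<le> pi * A N * exp ((real p - real N) * Re v)"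
      if "p \<le> N" "v \<in> sector r" for N v
      using r[OF that(2) tr[OF that(2)]] that(1) by (simp add: mult_nonpos_nonneg mult.assoc)
    moreover have "exp (real (Suc p) * (y - 1) - G y) \<le> Re m" for y
    proof (rule m)
      have Re: "Re (F p (of_real x)) = exp (real (Suc p) * x - s * Re (H (of_real x)))" for x
      proof -
        obtain h where h: "H (of_real x) = of_real h" using real[of x] by (auto elim: Reals_cases)
        have "F p (of_real x) = of_real (exp (real (Suc p) * x - s * h))"
          by (simp add: F_def h exp_of_real[symmetric])
        then show ?thesis by (simp add: h)
      qed
      show "Re (F p (of_real x)) \<ge> 0" for x by (simp add: Re)
      fix x assume x: "y - 1 \<le> x" "x \<le> y"
      have "real (Suc p) * (y - 1) \<le> real (Suc p) * x" using x by (intro mult_left_mono) auto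
      moreover have "s * Re (H (of_real x)) \<le> G y"
        using low[of x] G x(2) by (meson monoD order_trans)
      ultimately have "real (Suc p) * (y - 1) - G y \<le> real (Suc p) * x - s * Re (H (of_real x))"
        by linarith
      then show "exp (real (Suc p) * (y - 1) - G y) \<le> Re (F p (of_real x))"
        unfolding Re by (simp only: exp_le_cancel_iff)
    qed
    ultimately show ?thesis using h by blast
  qed
  then show thesis using that by metis
qed

text \<open>In the coordinate \<open>z = exp w\<close> this is the integral of \<open>e (u / z) g u / z\<close> over \<open>0 < u < exp L\<close>,
  where \<open>e\<close> is the flat function with truncated moments \<open>\<Psi> p\<close> and moments \<open>m p\<close>, and
  \<open>g u = (\<Sum>p. b p u\<^sup>p / m p)\<close> is the formal Borel transform. Integrating term by term yields a series
  that serves as the definition here and makes no reference to integrals.\<close>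

definition truncated_laplace ::
    "(nat \<Rightarrow> complex \<Rightarrow> complex) \<Rightarrow> (nat \<Rightarrow> complex) \<Rightarrow> real \<Rightarrow> (nat \<Rightarrow> complex) \<Rightarrow> complex \<Rightarrow> complex" where
  "truncated_laplace \<Psi> m L b w =
     (\<Sum>p. b p / m p * exp (of_nat p * w) * \<Psi> p (of_real L - w))"

text \<open>The truncated Laplace transform of coefficients with \<open>\<bar>b p\<bar> \<le> K B\<^sup>p \<bar>m p\<bar>\<close>. Truncating at
  \<open>L = - ln (2 B)\<close> makes the series converge uniformly on the whole sector. In the remainder after
  \<open>N\<close> terms, the terms with \<open>p \<ge> N\<close> are estimated by \<open>\<Psi> p\<close> and those with \<open>p < N\<close> by
  \<open>m p - \<Psi> p\<close>; all of them are \<open>O((2 B)\<^sup>N A\<^sub>N \<bar>z\<bar>\<^sup>N)\<close>.\<close>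

lemma truncated_laplace_expansion:
  fixes \<Psi> :: "nat \<Rightarrow> complex \<Rightarrow> complex" and m :: "nat \<Rightarrow> complex" and b :: "nat \<Rightarrow> complex"
  assumes hol: "\<And>p. \<Psi> p holomorphic_on sector r"
    and left: "\<And>p N v. v \<in> sector r \<Longrightarrow> N \<le> p \<Longrightarrow>
      norm (\<Psi> p v) \<le> A N * exp ((real p - real N) * Re v)"
    and right: "\<And>p N v. v \<in> sector r \<Longrightarrow> p \<le> N \<Longrightarrow>
      norm (m p - \<Psi> p v) \<le> A N * exp ((real p - real N) * Re v)"
    and A: "\<And>N. A N \<ge> 0"
    and m: "\<And>p. m p \<noteq> 0" and "B > 0" and b: "\<And>p. norm (b p) \<le> K * B ^ p * norm (m p)"
  defines "f \<equiv> truncated_laplace \<Psi> m (- ln (2 * B)) b"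
  shows truncated_laplace_summable: "w \<in> sector r \<Longrightarrow>
      summable (\<lambda>p. b p / m p * exp (of_nat p * w) * \<Psi> p (of_real (- ln (2 * B)) - w))"
    and truncated_laplace_holomorphic: "f holomorphic_on sector r"
    and truncated_laplace_remainder: "w \<in> sector r \<Longrightarrow>
      norm (f w - (\<Sum>p<N. b p * exp (of_nat p * w))) \<le> 2 * K * A N * (2 * B) ^ N * exp (real N * Re w)"
proof -
  define L where "L = - ln (2 * B)"
  define T where "T p w = b p / m p * exp (of_nat p * w) * \<Psi> p (of_real L - w)" for p w
  have f: "f w = (\<Sum>p. T p w)" for w
    by (simp add: f_def truncated_laplace_def T_def L_def)
  have eL: "exp (real p * L) = 1 / (2 * B) ^ p" for p
    using \<open>B > 0\<close> by (simp add: L_def exp_minus ln_realpow[symmetric] inverse_eq_divide)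
  have Lw: "of_real L - w \<in> sector r" if "w \<in> sector r" for w
    using that by (simp add: sector_def)
  have "K \<ge> 0" using order_trans[OF norm_ge_zero b[of 0]] m[of 0] by (simp add: zero_le_mult_iff)
  have cp: "norm (b p / m p) * exp (real p * L) \<le> K * (1 / 2) ^ p" for p
  proof -
    have "norm (b p / m p) \<le> K * B ^ p"
      using b[of p] m[of p] by (simp add: norm_divide divide_le_eq)
    then have "norm (b p / m p) * exp (real p * L) \<le> K * B ^ p * exp (real p * L)"
      by (intro mult_right_mono) auto
    also have "\<dots> = K * (1 / 2) ^ p"
      using \<open>B > 0\<close> by (simp add: eL power_mult_distrib power_divide)
    finally show ?thesis .
  qed
  have geo: "(\<lambda>p. K * (1 / 2) ^ p * c) sums (2 * K * c)" for c
    using sums_mult2[OF sums_mult[OF geometric_sums[of "1 / 2 :: real"], of K], of c] by (simp add: ac_simps)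
  have term_le: "norm (b p / m p * exp (of_nat p * w) * X)
      \<le> K * (1 / 2) ^ p * (A N * (2 * B) ^ N * exp (real N * Re w))"
    if X: "norm X \<le> A N * exp ((real p - real N) * Re (of_real L - w))" for p N w X
  proof -
    have "norm (b p / m p * exp (of_nat p * w) * X)
        \<le> norm (b p / m p) * exp (real p * Re w) * (A N * exp ((real p - real N) * (L - Re w)))"
      using X unfolding norm_mult by (intro mult_mono) (auto simp: norm_divide)
    also have "\<dots> = norm (b p / m p) * exp (real p * L) *
        (A N * exp (real N * (Re w - L)))"
    proof -
      have "exp (real p * Re w) * exp ((real p - real N) * (L - Re w))
          = exp (real p * L) * exp (real N * (Re w - L))"
        unfolding exp_add[symmetric] by (simp add: algebra_simps)
      then show ?thesis by (simp add: ac_simps)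
    qed
    also have "\<dots> \<le> K * (1 / 2) ^ p * (A N * exp (real N * (Re w - L)))"
      by (intro mult_right_mono cp mult_nonneg_nonneg A) auto
    also have "exp (real N * (Re w - L)) = (2 * B) ^ N * exp (real N * Re w)"
      using eL[of N] by (simp add: right_diff_distrib exp_diff)
    finally show ?thesis by (simp only: mult.assoc)
  qed
  have T0: "norm (T p w) \<le> K * (1 / 2) ^ p * A 0" if "w \<in> sector r" for p w
    using term_le[of "\<Psi> p (of_real L - w)" 0 p w] left[OF Lw[OF that], of 0 p] by (simp add: T_def)
  have sumT: "summable (\<lambda>p. T p w)" if "w \<in> sector r" for w
    by (rule summable_comparison_test'[OF sums_summable[OF geo[of "A 0"]]]) (use T0[OF that] in auto)
  then show "summable (\<lambda>p. b p / m p * exp (of_nat p * w) * \<Psi> p (of_real (- ln (2 * B)) - w))"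
    if "w \<in> sector r" using that by (simp add: T_def L_def)
  show "f holomorphic_on sector r"
  proof (rule holomorphic_uniform_sequence[OF open_sector, of "\<lambda>N w. \<Sum>p<N. T p w"])
    have "(\<lambda>w. \<Psi> p (of_real L - w)) holomorphic_on sector r" for p
    proof -
      have "(\<Psi> p \<circ> (\<lambda>w. of_real L - w)) holomorphic_on sector r"
        using Lw by (intro holomorphic_on_compose_gen[OF _ hol[of p]] holomorphic_intros) auto
      then show ?thesis by (simp add: o_def)
    qed
    then show "(\<lambda>w. \<Sum>p<N. T p w) holomorphic_on sector r" for N
      unfolding T_def using m by (intro holomorphic_intros) auto
  next
    fix w assume w: "w \<in> sector r"
    obtain d where d: "d > 0" "cball w d \<subseteq> sector r"
      using open_sector[of r] w by (auto simp: open_contains_cball)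
    have "uniform_limit (cball w d) (\<lambda>N w. \<Sum>p<N. T p w) f sequentially"
      unfolding f
      by (rule Weierstrass_m_test[OF _ sums_summable[OF geo[of "A 0"]]]) (use T0 d in auto)
    with d show "\<exists>d>0. cball w d \<subseteq> sector r \<and>
        uniform_limit (cball w d) (\<lambda>N w. \<Sum>p<N. T p w) f sequentially" by blast
  qed
  show "norm (f w - (\<Sum>p<N. b p * exp (of_nat p * w))) \<le> 2 * K * A N * (2 * B) ^ N * exp (real N * Re w)"
    if w: "w \<in> sector r"
  proof -
    define U where "U p = T p w - (if p < N then b p * exp (of_nat p * w) else 0)" for p
    have "(\<lambda>p. if p < N then b p * exp (of_nat p * w) else 0) sums (\<Sum>p<N. b p * exp (of_nat p * w))"
      using sums_If_finite_set[of "{..<N}" "\<lambda>p. b p * exp (of_nat p * w)"] by simp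
    then have U: "U sums (f w - (\<Sum>p<N. b p * exp (of_nat p * w)))"
      unfolding U_def f by (intro sums_diff summable_sums sumT w)
    define c where "c = A N * (2 * B) ^ N * exp (real N * Re w)"
    have Ule: "norm (U p) \<le> K * (1 / 2) ^ p * c" for p
    proof (cases "p < N")
      case True
      have "U p = b p / m p * exp (of_nat p * w) * (\<Psi> p (of_real L - w) - m p)"
        using True m[of p] by (simp add: U_def T_def right_diff_distrib)
      then show ?thesis
        unfolding c_def using right[OF Lw[OF w], of p N] True
        by (simp only: ) (intro term_le, simp add: norm_minus_commute)
    next
      case False
      then have "U p = b p / m p * exp (of_nat p * w) * \<Psi> p (of_real L - w)"
        by (simp add: U_def T_def)
      then show ?thesis
        unfolding c_def using left[OF Lw[OF w], of N p] False
        by (simp only: not_less) (intro term_le, simp)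
    qed
    have "norm (f w - (\<Sum>p<N. b p * exp (of_nat p * w))) = norm (\<Sum>p. U p)"
      using U by (simp add: sums_iff)
    also have "\<dots> \<le> (\<Sum>p. K * (1 / 2) ^ p * c)"
      by (intro norm_suminf_le Ule sums_summable[OF geo])
    also have "\<dots> = 2 * K * c" using geo[of c] by (simp add: sums_iff)
    finally show ?thesis by (simp add: c_def ac_simps)
  qed
qed

section \<open>Derivatives on the surface\<close>

lemma surface_higher_deriv_Suc:
  "surface_higher_deriv (Suc p) f = surface_deriv (surface_higher_deriv p f)"
  by (simp add: surface_higher_deriv_def)

lemma surface_deriv_holomorphic:
  assumes "f holomorphic_on S" "open S" "w \<in> S"
  shows "surface_deriv f w = deriv f w / exp w"
  using assms by (intro surface_deriv_eq(2) holomorphic_on_imp_differentiable_at)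

lemma holomorphic_surface_higher_deriv:
  assumes "f holomorphic_on S" "open S"
  shows "surface_higher_deriv p f holomorphic_on S"
proof (induction p)
  case 0
  show ?case using assms by (simp add: surface_higher_deriv_def)
next
  case (Suc p)
  have "(\<lambda>w. deriv (surface_higher_deriv p f) w / exp w) holomorphic_on S"
    using Suc assms by (intro holomorphic_intros holomorphic_deriv) auto
  then show ?case
    by (rule holomorphic_transform)
      (simp add: surface_higher_deriv_Suc surface_deriv_holomorphic[OF Suc assms(2)])
qed

lemma surface_higher_deriv_cong:
  assumes "f holomorphic_on S" "g holomorphic_on S" "open S"
    and "\<And>w. w \<in> S \<Longrightarrow> f w = g w" and "w \<in> S"
  shows "surface_higher_deriv p f w = surface_higher_deriv p g w"
  using \<open>w \<in> S\<close>
proof (induction p arbitrary: w)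
  case 0
  then show ?case using assms by (simp add: surface_higher_deriv_def)
next
  case (Suc p)
  have hol: "surface_higher_deriv p f holomorphic_on S" "surface_higher_deriv p g holomorphic_on S"
    using assms by (auto intro: holomorphic_surface_higher_deriv)
  have "deriv (surface_higher_deriv p f) w = deriv (surface_higher_deriv p g) w"
    using complex_derivative_transform_within_open[OF hol \<open>open S\<close> Suc.prems Suc.IH] by simp
  then show ?case
    using Suc.prems hol \<open>open S\<close> by (simp add: surface_higher_deriv_Suc surface_deriv_holomorphic)
qed

text \<open>In the chart \<open>\<xi> \<mapsto> w\<^sub>0 + log (1 + \<xi>)\<close> at \<open>w\<^sub>0\<close>, which is the coordinate \<open>z = z\<^sub>0 (1 + \<xi>)\<close>,
  the derivatives on the surface become ordinary ones, up to the powers of \<open>z\<^sub>0\<close>.\<close>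

lemma surface_higher_deriv_chart:
  assumes hol: "f holomorphic_on S" "open S" and "\<rho> \<le> 1"
    and S: "\<And>\<xi>. norm \<xi> < \<rho> \<Longrightarrow> w0 + Ln (1 + \<xi>) \<in> S"
    and \<xi>: "norm \<xi> < \<rho>"
  defines "g \<equiv> \<lambda>\<xi>. f (w0 + Ln (1 + \<xi>))"
  shows "(deriv ^^ p) g \<xi> = exp (of_nat p * w0) * surface_higher_deriv p f (w0 + Ln (1 + \<xi>))"
  using \<xi>
proof (induction p arbitrary: \<xi>)
  case 0
  then show ?case by (simp add: g_def surface_higher_deriv_def)
next
  case (Suc p)
  define D where "D = surface_higher_deriv p f"
  have D: "D holomorphic_on S"
    unfolding D_def by (rule holomorphic_surface_higher_deriv[OF hol])
  have wS: "w0 + Ln (1 + \<xi>) \<in> S" by (rule S[OF Suc.prems])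
  have re: "1 + \<xi> \<notin> \<real>\<^sub>\<le>\<^sub>0"
  proof
    assume "1 + \<xi> \<in> \<real>\<^sub>\<le>\<^sub>0"
    then have "Re \<xi> \<le> - 1" by (auto simp: complex_nonpos_Reals_iff)
    then show False using abs_Re_le_cmod[of \<xi>] Suc.prems \<open>\<rho> \<le> 1\<close> by linarith
  qed
  then have nz: "1 + \<xi> \<noteq> 0" by (metis nonpos_Reals_zero_I)
  have "((\<lambda>\<xi>. w0 + Ln (1 + \<xi>)) has_field_derivative inverse (1 + \<xi>)) (at \<xi>)"
    using re by (auto intro!: derivative_eq_intros)
  moreover have "(D has_field_derivative deriv D (w0 + Ln (1 + \<xi>))) (at (w0 + Ln (1 + \<xi>)))"
    by (rule holomorphic_derivI[OF D \<open>open S\<close> wS])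
  ultimately have "((\<lambda>\<xi>. D (w0 + Ln (1 + \<xi>))) has_field_derivative
      deriv D (w0 + Ln (1 + \<xi>)) * inverse (1 + \<xi>)) (at \<xi>)"
    by (rule DERIV_chain2[rotated])
  then have "((\<lambda>\<xi>. exp (of_nat p * w0) * D (w0 + Ln (1 + \<xi>))) has_field_derivative
      exp (of_nat p * w0) * (deriv D (w0 + Ln (1 + \<xi>)) * inverse (1 + \<xi>))) (at \<xi>)"
    by (rule DERIV_cmult)
  then have "((deriv ^^ p) g has_field_derivative
      exp (of_nat p * w0) * (deriv D (w0 + Ln (1 + \<xi>)) * inverse (1 + \<xi>))) (at \<xi>)"
    by (rule has_field_derivative_transform_within_open[of _ _ _ "ball 0 \<rho>"])
      (use Suc in \<open>auto simp: D_def\<close>)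
  then have "(deriv ^^ Suc p) g \<xi> =
      exp (of_nat p * w0) * (deriv D (w0 + Ln (1 + \<xi>)) * inverse (1 + \<xi>))"
    by (simp add: DERIV_imp_deriv)
  also have "\<dots> = exp (of_nat (Suc p) * w0) * (deriv D (w0 + Ln (1 + \<xi>)) / exp (w0 + Ln (1 + \<xi>)))"
  proof -
    have "E * (d * inverse u) = E * x * (d / (x * u))" if "x \<noteq> 0" "u \<noteq> 0" for E d u x :: complex
      using that by (simp add: field_simps)
    from this[OF exp_not_eq_zero nz, of "exp (of_nat p * w0)" _ w0]
    show ?thesis using nz by (simp add: exp_add distrib_right mult.commute[of "exp w0"])
  qed
  also have "deriv D (w0 + Ln (1 + \<xi>)) / exp (w0 + Ln (1 + \<xi>)) =
      surface_higher_deriv (Suc p) f (w0 + Ln (1 + \<xi>))"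
    by (simp add: surface_higher_deriv_Suc D_def[symmetric] surface_deriv_holomorphic[OF D \<open>open S\<close> wS])
  finally show ?case .
qed

lemma higher_deriv_truncated_poly:
  fixes c :: "nat \<Rightarrow> complex"
  assumes "M \<le> Suc N"
  shows "(deriv ^^ N) (\<lambda>\<xi>. \<Sum>p<M. c p * (1 + \<xi>) ^ p) 0 = (if M = Suc N then fact N * c N else 0)"
  using assms
proof (induction M)
  case 0
  have "(deriv ^^ N) (\<lambda>\<xi>::complex. 0) = (\<lambda>\<xi>. 0)"
    by (induction N) auto
  then show ?case by simp
next
  case (Suc M)
  have hol: "(\<lambda>\<xi>. c p * (1 + \<xi>) ^ p) holomorphic_on UNIV" "(\<lambda>\<xi>. (1 + \<xi>) ^ p) holomorphic_on UNIV" for p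
    by (intro holomorphic_intros)+
  have "(deriv ^^ N) (\<lambda>\<xi>. \<Sum>p<Suc M. c p * (1 + \<xi>) ^ p) 0 =
      (deriv ^^ N) (\<lambda>\<xi>. \<Sum>p<M. c p * (1 + \<xi>) ^ p) 0 + (deriv ^^ N) (\<lambda>\<xi>. c M * (1 + \<xi>) ^ M) 0"
    unfolding sum.lessThan_Suc
    by (intro higher_deriv_add[OF _ hol(1)] holomorphic_on_sum hol(1)) simp_all
  also have "(deriv ^^ N) (\<lambda>\<xi>. \<Sum>p<M. c p * (1 + \<xi>) ^ p) 0 = 0"
    using Suc by simp
  also have "(deriv ^^ N) (\<lambda>\<xi>. c M * (1 + \<xi>) ^ M) 0 = c M * (deriv ^^ N) (\<lambda>\<xi>. (1 + \<xi>) ^ M) 0"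
    by (rule higher_deriv_cmult[OF hol(2)]) auto
  also have "(deriv ^^ N) (\<lambda>\<xi>::complex. (1 + \<xi>) ^ M) 0 = pochhammer (of_nat (Suc M - N)) N"
    using higher_deriv_power[of N "- 1" M 0] by (simp add: add.commute[of _ 1] del: of_nat_diff)
  also have "\<dots> = (if M = N then fact N else 0)"
    using Suc.prems by (auto simp: pochhammer_fact[symmetric] pochhammer_0_left le_Suc_eq)
  finally show ?case by auto
qed

text \<open>An asymptotic expansion on a sector can be differentiated on smaller sectors, by Cauchy's
  estimate on discs of radius proportional to \<open>\<bar>z\<bar>\<close>. The remainder of order \<open>M = N\<close> bounds the
  \<open>N\<close>-th derivative; the remainder of order \<open>M = N + 1\<close> shows that it tends to \<open>N! b\<^sub>N\<close> at \<open>0\<close>.\<close>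

lemma expansion_derivatives:
  assumes "\<gamma> < r"
  obtains q :: real where "q \<ge> 1"
    and "\<And>f b R w N M. f holomorphic_on sector r \<Longrightarrow>
      (\<And>w. w \<in> sector r \<Longrightarrow> norm (f w - (\<Sum>p<M. b p * exp (of_nat p * w))) \<le> R * exp (real M * Re w)) \<Longrightarrow>
      w \<in> sector \<gamma> \<Longrightarrow> M \<le> Suc N \<Longrightarrow>
      norm (surface_higher_deriv N f w - (if M = Suc N then fact N * b N else 0))
        \<le> fact N * (R * q ^ (M + N)) * exp ((real M - real N) * Re w)"
proof -
  define \<rho> where "\<rho> = min (1 / 2) ((r - \<gamma>) * pi / 4)"
  have \<rho>: "\<rho> > 0" "\<rho> \<le> 1 / 2" "2 * \<rho> \<le> (r - \<gamma>) * pi / 2" using \<open>\<gamma> < r\<close> by (auto simp: \<rho>_def)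
  define \<delta> where "\<delta> = \<rho> / 2"
  have \<delta>: "\<delta> > 0" "\<delta> < \<rho>" "\<delta> \<le> 1" using \<rho> by (auto simp: \<delta>_def)
  define q where "q = 2 / \<delta>"
  have "q \<ge> 1" using \<delta> by (simp add: q_def)
  have q2: "q \<ge> 2" "q \<ge> 1 / \<delta>" using \<delta> by (auto simp: q_def field_simps)
  have "norm (surface_higher_deriv N f w - (if M = Suc N then fact N * b N else 0))
        \<le> fact N * (R * q ^ (M + N)) * exp ((real M - real N) * Re w)"
    if hol: "f holomorphic_on sector r"
      and R: "\<And>w. w \<in> sector r \<Longrightarrow> norm (f w - (\<Sum>p<M. b p * exp (of_nat p * w))) \<le> R * exp (real M * Re w)"
      and w: "w \<in> sector \<gamma>" and "M \<le> Suc N" for f b R w N M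
  proof -
    have S: "w + Ln (1 + \<xi>) \<in> sector r" if "norm \<xi> < \<rho>" for \<xi>
    proof -
      have "norm (Ln (1 + \<xi>)) \<le> 2 * norm \<xi>" using that \<rho> by (intro norm_Ln_le) auto
      then have "\<bar>Im (Ln (1 + \<xi>))\<bar> < 2 * \<rho>" using abs_Im_le_cmod[of "Ln (1 + \<xi>)"] that by linarith
      moreover have "\<bar>Im w\<bar> < \<gamma> * pi / 2" using w by (simp add: sector_def)
      ultimately have "\<bar>Im w + Im (Ln (1 + \<xi>))\<bar> < r * pi / 2"
        using \<rho>(3) by (simp only: left_diff_distrib diff_divide_distrib)
      then show ?thesis by (simp add: sector_def)
    qed
    have nz: "1 + \<xi> \<noteq> 0" "1 + \<xi> \<notin> \<real>\<^sub>\<le>\<^sub>0" if "norm \<xi> < \<rho>" for \<xi> :: complex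
    proof -
      have "Re (1 + \<xi>) > 0" using that \<rho> abs_Re_le_cmod[of \<xi>] by simp
      then show "1 + \<xi> \<notin> \<real>\<^sub>\<le>\<^sub>0" by (auto simp: complex_nonpos_Reals_iff)
      then show "1 + \<xi> \<noteq> 0" by (metis nonpos_Reals_zero_I)
    qed
    define g where "g \<xi> = f (w + Ln (1 + \<xi>))" for \<xi>
    define P where "P \<xi> = (\<Sum>p<M. b p * exp (of_nat p * w) * (1 + \<xi>) ^ p)" for \<xi>
    have eP: "exp (of_nat p * (w + Ln (1 + \<xi>))) = exp (of_nat p * w) * (1 + \<xi>) ^ p"
      if "norm \<xi> < \<rho>" for p \<xi>
      using nz[OF that] by (simp add: distrib_left exp_add exp_of_nat_mult)
    have holg: "g holomorphic_on ball 0 \<rho>"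
    proof -
      have "(f \<circ> (\<lambda>\<xi>. w + Ln (1 + \<xi>))) holomorphic_on ball 0 \<rho>"
        using nz S by (intro holomorphic_on_compose_gen[OF _ hol] holomorphic_intros) auto
      then show ?thesis by (simp add: g_def[abs_def] o_def)
    qed
    have holP: "P holomorphic_on ball 0 \<rho>"
      unfolding P_def by (intro holomorphic_intros)
    have holgP: "(\<lambda>\<xi>. g \<xi> - P \<xi>) holomorphic_on ball 0 \<rho>"
      by (intro holomorphic_intros holg holP)
    have "R \<ge> 0"
      using order_trans[OF norm_ge_zero R[OF S[of 0]]] \<rho> by (simp add: zero_le_mult_iff)
    have bound: "norm (g \<xi> - P \<xi>) \<le> R * (2 ^ M * exp (real M * Re w))" if "norm \<xi> = \<delta>" for \<xi>
    proof -
      have \<xi>: "norm \<xi> < \<rho>" using that \<delta> by simp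
      have "g \<xi> - P \<xi> = f (w + Ln (1 + \<xi>)) - (\<Sum>p<M. b p * exp (of_nat p * (w + Ln (1 + \<xi>))))"
        unfolding g_def P_def eP[OF \<xi>] by (simp add: mult.assoc)
      then have "norm (g \<xi> - P \<xi>) \<le> R * exp (real M * Re (w + Ln (1 + \<xi>)))"
        using R[OF S[OF \<xi>]] by simp
      also have "exp (real M * Re (w + Ln (1 + \<xi>))) = norm (1 + \<xi>) ^ M * exp (real M * Re w)"
        using nz[OF \<xi>] by (simp add: distrib_left exp_add exp_of_nat_mult)
      also have "\<dots> \<le> 2 ^ M * exp (real M * Re w)"
      proof -
        have "norm (1 + \<xi>) \<le> 2" using norm_triangle_ineq[of 1 \<xi>] that \<delta> by simp
        then show ?thesis by (intro mult_right_mono power_mono) auto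
      qed
      finally show ?thesis using \<open>R \<ge> 0\<close> by (simp add: mult_left_mono)
    qed
    have "norm ((deriv ^^ N) (\<lambda>\<xi>. g \<xi> - P \<xi>) 0) \<le> fact N * (R * (2 ^ M * exp (real M * Re w))) / \<delta> ^ N"
    proof (rule Cauchy_inequality)
      show "(\<lambda>\<xi>. g \<xi> - P \<xi>) holomorphic_on ball 0 \<delta>"
        using holgP \<delta> by (auto intro: holomorphic_on_subset)
      show "continuous_on (cball 0 \<delta>) (\<lambda>\<xi>. g \<xi> - P \<xi>)"
        using \<delta> by (intro holomorphic_on_imp_continuous_on holomorphic_on_subset[OF holgP]) auto
    qed (use \<delta> bound in auto)
    moreover have "(deriv ^^ N) (\<lambda>\<xi>. g \<xi> - P \<xi>) 0 =
        exp (of_nat N * w) * (surface_higher_deriv N f w - (if M = Suc N then fact N * b N else 0))"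
    proof -
      have "(deriv ^^ N) (\<lambda>\<xi>. g \<xi> - P \<xi>) 0 = (deriv ^^ N) g 0 - (deriv ^^ N) P 0"
        using \<rho> by (intro higher_deriv_diff[OF holg holP]) auto
      also have "(deriv ^^ N) g 0 = exp (of_nat N * w) * surface_higher_deriv N f w"
        unfolding g_def using surface_higher_deriv_chart[OF hol open_sector _ S, of \<rho> 0 N] \<rho> by simp
      also have "(deriv ^^ N) P 0 = (if M = Suc N then fact N * (b N * exp (of_nat N * w)) else 0)"
        unfolding P_def by (rule higher_deriv_truncated_poly[OF \<open>M \<le> Suc N\<close>])
      finally show ?thesis by (cases "M = Suc N") (simp_all add: algebra_simps)
    qed
    ultimately have "exp (real N * Re w) *
        norm (surface_higher_deriv N f w - (if M = Suc N then fact N * b N else 0))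
        \<le> fact N * (R * (2 ^ M * exp (real M * Re w))) / \<delta> ^ N"
      by (simp add: norm_mult)
    also have "\<dots> = fact N * (R * (2 ^ M * (1 / \<delta>) ^ N)) * exp (real M * Re w)"
      by (simp add: power_divide)
    also have "\<dots> \<le> fact N * (R * (q ^ M * q ^ N)) * exp (real M * Re w)"
      using \<open>R \<ge> 0\<close> q2 \<delta> by (intro mult_right_mono mult_left_mono mult_mono power_mono) auto
    also have "\<dots> = exp (real N * Re w) *
        (fact N * (R * q ^ (M + N)) * exp ((real M - real N) * Re w))"
      by (simp add: power_add left_diff_distrib exp_diff)
    finally show ?thesis by (simp only: mult_le_cancel_left_pos exp_gt_zero)
  qed
  with \<open>q \<ge> 1\<close> show thesis using that by blast
qed

lemma to_zero_in_sector_nontrivial: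
  assumes "\<gamma> > 0"
  shows "to_zero_in (sector \<gamma>) \<noteq> bot"
proof
  assume bot: "to_zero_in (sector \<gamma>) = bot"
  have "filterlim (\<lambda>x. complex_of_real x) (to_zero_in (sector \<gamma>)) at_bot"
    unfolding to_zero_in_def filterlim_inf filterlim_filtercomap_iff filterlim_principal
  proof
    have "((\<lambda>x. complex_of_real (exp x)) \<longlongrightarrow> of_real 0) at_bot"
      by (intro tendsto_of_real exp_at_bot)
    then show "filterlim (exp \<circ> complex_of_real) (nhds 0) at_bot"
      by (simp add: o_def exp_of_real)
  qed (simp add: of_real_in_sector[OF assms])
  then show False by (simp add: bot filterlim_def bot_unique filtermap_bot_iff)
qed

lemma borel_map_eqI:
  assumes "\<gamma> > 0"
    and "\<And>w. w \<in> sector \<gamma> \<Longrightarrow> norm (surface_higher_deriv N f w - c) \<le> K * exp (Re w)"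
  shows "borel_map (sector \<gamma>) f N = c"
  unfolding borel_map_def
proof (rule tendsto_Lim[OF to_zero_in_sector_nontrivial[OF \<open>\<gamma> > 0\<close>]])
  have in_sector: "\<forall>\<^sub>F w in to_zero_in (sector \<gamma>). w \<in> sector \<gamma>"
    by (simp add: to_zero_in_def eventually_inf_principal)
  have "filterlim exp (nhds 0) (to_zero_in (sector \<gamma>))"
    unfolding to_zero_in_def by (intro filterlim_mono[OF filterlim_filtercomap]) auto
  then have "((\<lambda>w. K * norm (exp w)) \<longlongrightarrow> K * norm (0::complex)) (to_zero_in (sector \<gamma>))"
    by (intro tendsto_intros)
  then have lim: "((\<lambda>w. K * exp (Re w)) \<longlongrightarrow> 0) (to_zero_in (sector \<gamma>))" by simp
  have "\<forall>\<^sub>F w in to_zero_in (sector \<gamma>). norm (surface_higher_deriv N f w - c) \<le> K * exp (Re w)"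
    using in_sector by (rule eventually_mono) (rule assms(2))
  then have "((\<lambda>w. surface_higher_deriv N f w - c) \<longlongrightarrow> 0) (to_zero_in (sector \<gamma>))"
    by (rule Lim_null_comparison[OF _ lim])
  then show "(surface_higher_deriv N f \<longlongrightarrow> c) (to_zero_in (sector \<gamma>))"
    by (simp add: LIM_zero_iff)
qed

section \<open>The extension operator\<close>

lemma Lambda_norm_less_D:
  assumes "Lambda_norm \<tau> l a < ennreal \<delta>"
  shows "norm (a p) \<le> \<delta> * weight_matrix \<tau> l p"
proof -
  have "ennreal (norm (a p) / weight_matrix \<tau> l p) \<le> Lambda_norm \<tau> l a"
    unfolding Lambda_norm_def by (rule SUP_upper) auto
  also note assms
  finally have "norm (a p) / weight_matrix \<tau> l p < \<delta>"
    using weight_matrix_pos[of \<tau> l p] by (subst (asm) ennreal_less_iff) auto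
  then show ?thesis using weight_matrix_pos[of \<tau> l p] by (simp add: divide_less_eq less_imp_le)
qed

lemma Lambda_space_iff:
  "a \<in> Lambda_space \<tau> l \<longleftrightarrow> (\<exists>K. \<forall>p. norm (a p) \<le> K * weight_matrix \<tau> l p)"
proof
  assume "a \<in> Lambda_space \<tau> l"
  then have "Lambda_norm \<tau> l a < \<infinity>" by (simp add: Lambda_space_def)
  then obtain K where "Lambda_norm \<tau> l a = ennreal K" "K \<ge> 0"
    by (cases "Lambda_norm \<tau> l a") auto
  then have "Lambda_norm \<tau> l a < ennreal (K + 1)" by (simp add: ennreal_less_iff)
  then show "\<exists>K. \<forall>p. norm (a p) \<le> K * weight_matrix \<tau> l p" using Lambda_norm_less_D by blast
next
  assume "\<exists>K. \<forall>p. norm (a p) \<le> K * weight_matrix \<tau> l p"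
  then obtain K where "\<And>p. norm (a p) \<le> K * weight_matrix \<tau> l p" by blast
  then have "Lambda_norm \<tau> l a \<le> ennreal K"
    unfolding Lambda_norm_def using weight_matrix_pos[of \<tau> l]
    by (intro SUP_least ennreal_leI) (simp add: divide_le_eq)
  then show "a \<in> Lambda_space \<tau> l"
    by (auto simp: Lambda_space_def intro: le_less_trans ennreal_less_top)
qed

lemma A_norm_le:
  assumes "\<And>w p. w \<in> S \<Longrightarrow> norm (surface_higher_deriv p f w) \<le> K * weight_matrix \<tau> l p"
  shows "A_norm \<tau> l S f \<le> ennreal K"
  unfolding A_norm_def
proof (rule SUP_least, clarify)
  fix w p assume "w \<in> S"
  show "ennreal (norm (surface_higher_deriv p f w) / weight_matrix \<tau> l p) \<le> ennreal K"
    using assms[OF \<open>w \<in> S\<close>, of p] weight_matrix_pos[of \<tau> l p]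
    by (intro ennreal_leI) (simp add: divide_le_eq)
qed

text \<open>The operator sends \<open>a\<close> to the truncated Laplace transform of \<open>(a\<^sub>p / p!)\<^sub>p\<close>.\<close>

lemma extension_operator:
  assumes W: "\<sigma> \<in> class_W" "\<omega> \<in> class_W" and O: "\<omega> \<in> O[at_top](\<sigma>)"
    and "0 < \<gamma>" and r: "\<gamma> < r" "gamma_condition \<sigma> \<omega> r"
    and x: "x1 > 0" "x2 > 0" and "l > 0"
    and \<tau>1: "\<tau>1 = omega_seq (hat (weight_matrix \<sigma> x1))"
    and \<tau>2: "\<tau>2 = omega_seq (hat (weight_matrix \<omega> x2))"
  obtains l1 C :: real and E :: "(nat \<Rightarrow> complex) \<Rightarrow> complex \<Rightarrow> complex"
  where "l1 > 0" and "C \<ge> 0"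
    and "\<And>a K. (\<And>p. norm (a p) \<le> K * weight_matrix \<tau>1 l p) \<Longrightarrow>
      A_norm \<tau>2 l1 (sector \<gamma>) (E a) \<le> ennreal (K * C)"
    and "\<And>a. a \<in> Lambda_space \<tau>1 l \<Longrightarrow> E a \<in> A_space \<tau>2 l1 (sector \<gamma>)"
    and "\<And>a. a \<in> Lambda_space \<tau>1 l \<Longrightarrow> borel_map (sector \<gamma>) (E a) = a"
    and "linear_map_on (Lambda_space \<tau>1 l) E"
proof (rule expansion_derivatives[OF r(1)])
  fix q :: real
  assume "q \<ge> 1"
    and deriv_bound: "\<And>f b R w N M. f holomorphic_on sector r \<Longrightarrow>
      (\<And>w. w \<in> sector r \<Longrightarrow> norm (f w - (\<Sum>p<M. b p * exp (of_nat p * w))) \<le> R * exp (real M * Re w)) \<Longrightarrow>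
      w \<in> sector \<gamma> \<Longrightarrow> M \<le> Suc N \<Longrightarrow>
      norm (surface_higher_deriv N f w - (if M = Suc N then fact N * b N else 0))
        \<le> fact N * (R * q ^ (M + N)) * exp ((real M - real N) * Re w)"
  have "r > 0" using \<open>0 < \<gamma>\<close> r(1) by simp
  obtain H c C where hol: "H holomorphic_on sector r" and "c > 0" "C > 0"
    and H_low: "\<And>w. w \<in> sector r \<Longrightarrow> c * phi \<omega> (Re w) \<le> Re (H w)"
    and H_real: "\<And>x. H (of_real x) \<in> \<real>" and H_up: "\<And>x. Re (H (of_real x)) \<le> C * phi \<sigma> x + C"
    using that by (rule holomorphic_weight[OF W(2,1) O \<open>r > 0\<close> r(2)])
  define k where "k = nat \<lceil>l\<rceil>"
  have k: "real k \<ge> l" "k \<ge> 1" using \<open>l > 0\<close> by (auto simp: k_def real_nat_ceiling_ge Suc_le_eq)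
  define x' where "x' = real k * x1"
  have "x' > 0" using k x by (simp add: x'_def)
  \<comment> \<open>The power \<open>s\<close> of the flat function is chosen so that, up to geometric factors, its moments
    dominate the sequence with index \<open>k x1\<close> in the weight matrix of \<open>\<sigma>\<close>.\<close>
  define s where "s = 1 / (C * x')"
  have "s > 0" using \<open>C > 0\<close> \<open>x' > 0\<close> by (simp add: s_def)
  \<comment> \<open>\<open>B\<close> bounds the growth of \<open>a\<^sub>p / (p! m\<^sub>p)\<close>: one factor \<open>e k\<close> comes from comparing the weight
    matrix of \<open>\<tau>1\<close> with \<open>p! S\<^sub>p\<close>, another factor \<open>e\<close> from comparing \<open>S\<^sub>p\<close> with \<open>m\<^sub>p\<close>.\<close>
  define B where "B = exp 2 * real k"
  have "B \<ge> 1" using k mult_mono[of 1 "exp 2" 1 "real k"] by (simp add: B_def)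
  \<comment> \<open>\<open>exp (h p)\<close> collects the factor \<open>(2 B)\<^sup>p\<close> of the remainder estimate and the factor \<open>q\<^sup>2\<^sup>p\<close> of
    Cauchy's estimate.\<close>
  define h where "h = ln (2 * B * q ^ 2)"
  have "1 \<le> 2 * B * q ^ 2"
    using mult_mono[of 1 "2 * B" 1 "q ^ 2"] \<open>B \<ge> 1\<close> \<open>q \<ge> 1\<close> by (simp add: one_le_power)
  then have "h \<ge> 0" by (simp add: h_def)
  have eh: "exp (h * real p) = (2 * B) ^ p * q ^ (p + p)" for p
    using \<open>1 \<le> 2 * B * q ^ 2\<close>
    by (simp add: h_def mult.commute[of _ "real p"] exp_of_nat_mult power_mult_distrib
        power_mult[symmetric] mult_2[symmetric])
  have "s * c > 0" using \<open>s > 0\<close> \<open>c > 0\<close> by simp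
  obtain C' l1 where "1 \<le> l1" "C' > 0" and absorb:
    "\<And>p u. exp (h * real p) * exp (real (Suc p) * u + \<bar>u\<bar> - s * c * phi \<omega> u) * fact p
        \<le> C' * weight_matrix \<tau>2 l1 p"
    using that unfolding \<tau>2 by (rule weight_absorb[OF W(2) x(2) \<open>s * c > 0\<close> \<open>h \<ge> 0\<close>])
  define A where "A p = C' * weight_matrix \<tau>2 l1 p / (exp (h * real p) * fact p)" for p
  have A_eq: "A p * ((2 * B) ^ p * q ^ (p + p)) * fact p = C' * weight_matrix \<tau>2 l1 p" for p
    unfolding eh[symmetric] by (simp add: A_def)
  define G where "G y = s * (C * phi \<sigma> y + C)" for y
  have G_eq: "G y = phi \<sigma> y / x' + 1 / x'" for y
    using \<open>C > 0\<close> \<open>x' > 0\<close> by (simp add: G_def s_def field_simps)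
  have "mono G"
    using \<open>x' > 0\<close> by (auto simp: mono_def G_eq intro!: divide_right_mono phi_mono[OF W(1)])
  have A_bound: "exp (real (Suc N) * Re v + \<bar>Re v\<bar> - s * Re (H v)) \<le> A N" if "v \<in> sector r" for N v
  proof -
    have "s * (c * phi \<omega> (Re v)) \<le> s * Re (H v)"
      using H_low[OF that] \<open>s > 0\<close> by (intro mult_left_mono) auto
    then have "exp (real (Suc N) * Re v + \<bar>Re v\<bar> - s * Re (H v))
        \<le> exp (real (Suc N) * Re v + \<bar>Re v\<bar> - s * c * phi \<omega> (Re v))"
      by simp
    also have "\<dots> \<le> A N"
      using absorb[of N "Re v"] by (simp add: A_def pos_le_divide_eq mult.commute mult.left_commute)
    finally show ?thesis .
  qed
  have G_low: "s * Re (H (of_real y)) \<le> G y" for y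
    unfolding G_def using H_up[of y] \<open>s > 0\<close> by (intro mult_left_mono) auto
  show thesis
  proof (rule truncated_moments[OF \<open>r > 0\<close> hol A_bound H_real G_low \<open>mono G\<close>])
    fix \<Psi> :: "nat \<Rightarrow> complex \<Rightarrow> complex" and m :: "nat \<Rightarrow> complex"
    assume \<Psi>: "\<And>p. \<Psi> p holomorphic_on sector r"
      "\<And>p N v. v \<in> sector r \<Longrightarrow> N \<le> p \<Longrightarrow> norm (\<Psi> p v) \<le> pi * A N * exp ((real p - real N) * Re v)"
      "\<And>p N v. v \<in> sector r \<Longrightarrow> p \<le> N \<Longrightarrow> norm (m p - \<Psi> p v) \<le> pi * A N * exp ((real p - real N) * Re v)"
      and m: "\<And>p y. exp (real (Suc p) * (y - 1) - G y) \<le> Re (m p)"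
    have A0: "pi * A N \<ge> 0" for N
      using \<open>C' > 0\<close> weight_matrix_pos[of \<tau>2 l1 N] by (simp add: A_def)
    have Rem: "Re (m p) > 0" for p using m[of p 0] by (rule less_le_trans[rotated]) simp
    then have m0: "m p \<noteq> 0" for p by (metis less_irrefl zero_complex.sel(1))
    define c1 where "c1 = exp (1 + 1 / x')"
    have S_le: "weight_matrix \<sigma> x' p \<le> c1 * exp (real p) * norm (m p)" for p
    proof -
      have "weight_matrix \<sigma> x' p \<le> exp (ln (Re (m p)) + (real (Suc p) + 1 / x'))"
      proof (rule weight_matrix_le[OF \<open>x' > 0\<close>])
        fix y :: real assume "y \<ge> 0"
        have "real (Suc p) * (y - 1) - G y \<le> ln (Re (m p))"
          using m[of p y] Rem[of p] by (simp add: ln_ge_iff)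
        then show "real p * y - phi \<sigma> y / x' \<le> ln (Re (m p)) + (real (Suc p) + 1 / x')"
          using \<open>y \<ge> 0\<close> by (simp add: G_eq algebra_simps)
      qed
      also have "\<dots> = exp (ln (Re (m p))) * (exp (1 + 1 / x') * exp (real p))"
        unfolding exp_add[symmetric] by (simp add: algebra_simps)
      also have "\<dots> = c1 * exp (real p) * Re (m p)"
        using Rem[of p] by (simp add: c1_def)
      also have "\<dots> \<le> c1 * exp (real p) * norm (m p)"
        by (intro mult_left_mono complex_Re_le_cmod) (auto simp: c1_def)
      finally show ?thesis .
    qed
    have b_le: "norm (a p / fact p) \<le> K * c1 * B ^ p * norm (m p)"
      if a: "\<And>p. norm (a p) \<le> K * weight_matrix \<tau>1 l p" and "K \<ge> 0" for a :: "nat \<Rightarrow> complex" and K p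
    proof -
      have "norm (a p) \<le> K * weight_matrix \<tau>1 l p" by (rule a)
      also have "weight_matrix \<tau>1 l p \<le> exp (real p * ln (exp 1 * k)) * fact p * weight_matrix \<sigma> x' p"
        unfolding \<tau>1 x'_def by (rule weight_matrix_omega_seq_le[OF W(1) x(1) \<open>l > 0\<close> k(1)])
      also have "\<dots> \<le> exp (real p * ln (exp 1 * k)) * fact p * (c1 * exp (real p) * norm (m p))"
        by (intro mult_left_mono S_le) auto
      also have "exp (real p * ln (exp 1 * k)) = (exp 1 * k) ^ p"
        using k by (simp add: exp_of_nat_mult)
      also have "(exp 1 * k) ^ p * fact p * (c1 * exp (real p) * norm (m p)) = fact p * (c1 * B ^ p * norm (m p))"
      proof -
        have "(exp 1 * k) ^ p * exp (real p) = B ^ p"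
        proof -
          have "exp (real p) = exp 1 ^ p" using exp_of_nat_mult[of p "1::real"] by simp
          moreover have "exp 2 = exp 1 * exp (1::real)" by (simp add: exp_add[symmetric])
          ultimately show ?thesis by (simp add: B_def power_mult_distrib)
        qed
        then show ?thesis by (simp add: ac_simps)
      qed
      finally have "norm (a p) \<le> K * (fact p * (c1 * B ^ p * norm (m p)))"
        using \<open>K \<ge> 0\<close> by (simp add: mult_left_mono)
      then show ?thesis by (simp add: norm_divide divide_le_eq ac_simps)
    qed
    define L where "L = - ln (2 * B)"
    define f where "f a = truncated_laplace \<Psi> m L (\<lambda>p. a p / fact p)" for a
    define E where "E a w = (if w \<in> sector \<gamma> then f a w else 0)" for a w
    have sub: "sector \<gamma> \<subseteq> sector r"
    proof
      fix w assume "w \<in> sector \<gamma>"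
      moreover have "\<gamma> * pi \<le> r * pi" using r(1) by (intro mult_right_mono) auto
      ultimately show "w \<in> sector r" unfolding sector_def mem_Collect_eq by linarith
    qed
    have K0: "K \<ge> 0" if "\<And>p. norm (a p) \<le> K * weight_matrix \<tau>1 l p" for a :: "nat \<Rightarrow> complex" and K
      using order_trans[OF norm_ge_zero that[of 0]] weight_matrix_pos[of \<tau>1 l 0]
      by (simp add: zero_le_mult_iff)
    have "B > 0" using \<open>B \<ge> 1\<close> by simp
    have f_summable: "w \<in> sector r \<Longrightarrow>
          summable (\<lambda>p. a p / fact p / m p * exp (of_nat p * w) * \<Psi> p (of_real L - w))"
      and f_hol: "f a holomorphic_on sector r"
      and f_rem: "\<And>w N. w \<in> sector r \<Longrightarrow> norm (f a w - (\<Sum>p<N. a p / fact p * exp (of_nat p * w)))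
          \<le> 2 * (K * c1) * (pi * A N) * (2 * B) ^ N * exp (real N * Re w)"
      if a: "\<And>p. norm (a p) \<le> K * weight_matrix \<tau>1 l p" for a K w
    proof -
      have b: "norm (a p / fact p) \<le> K * c1 * B ^ p * norm (m p)" for p
        by (rule b_le[OF a K0[OF a]])
      show "summable (\<lambda>p. a p / fact p / m p * exp (of_nat p * w) * \<Psi> p (of_real L - w))"
        if "w \<in> sector r" unfolding L_def
        by (rule truncated_laplace_summable[where A = "\<lambda>N. pi * A N" and K = "K * c1"])
          (assumption | rule \<Psi> A0 m0 \<open>B > 0\<close> b that)+
      show "f a holomorphic_on sector r" unfolding f_def L_def
        by (rule truncated_laplace_holomorphic[where A = "\<lambda>N. pi * A N" and K = "K * c1"])
          (assumption | rule \<Psi> A0 m0 \<open>B > 0\<close> b)+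
      show "norm (f a w - (\<Sum>p<N. a p / fact p * exp (of_nat p * w)))
          \<le> 2 * (K * c1) * (pi * A N) * (2 * B) ^ N * exp (real N * Re w)"
        if "w \<in> sector r" for w N unfolding f_def L_def
        by (rule truncated_laplace_remainder[where A = "\<lambda>N. pi * A N" and K = "K * c1"])
          (assumption | rule \<Psi> A0 m0 \<open>B > 0\<close> b that)+
    qed
    have E_deriv: "surface_higher_deriv N (E a) w = surface_higher_deriv N (f a) w"
      if a: "\<And>p. norm (a p) \<le> K * weight_matrix \<tau>1 l p" and w: "w \<in> sector \<gamma>" for a K N w
    proof (rule surface_higher_deriv_cong[OF _ _ open_sector _ w])
      show f: "f a holomorphic_on sector \<gamma>" by (rule holomorphic_on_subset[OF f_hol[OF a] sub])
      show "E a holomorphic_on sector \<gamma>" by (rule holomorphic_transform[OF f]) (simp add: E_def)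
    qed (simp add: E_def)
    define Cf where "Cf = 2 * c1 * pi * C'"
    have "Cf \<ge> 0" using \<open>C' > 0\<close> by (simp add: Cf_def c1_def)
    have norm_E: "A_norm \<tau>2 l1 (sector \<gamma>) (E a) \<le> ennreal (K * Cf)"
      if a: "\<And>p. norm (a p) \<le> K * weight_matrix \<tau>1 l p" for a K
    proof (rule A_norm_le)
      fix w N assume w: "w \<in> sector \<gamma>"
      have "norm (surface_higher_deriv N (f a) w) \<le>
          fact N * (2 * (K * c1) * (pi * A N) * (2 * B) ^ N * q ^ (N + N))"
        using deriv_bound[OF f_hol[OF a] f_rem[OF a] w, of N N] by simp
      also have "\<dots> = K * (2 * c1 * pi) * (A N * ((2 * B) ^ N * q ^ (N + N)) * fact N)"
        by (simp only: ac_simps)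
      also have "\<dots> = K * Cf * weight_matrix \<tau>2 l1 N"
        unfolding A_eq by (simp add: Cf_def)
      finally show "norm (surface_higher_deriv N (E a) w) \<le> K * Cf * weight_matrix \<tau>2 l1 N"
        unfolding E_deriv[OF a w] .
    qed
    have E_space: "E a \<in> A_space \<tau>2 l1 (sector \<gamma>)" if "a \<in> Lambda_space \<tau>1 l" for a
    proof -
      obtain K where a: "\<And>p. norm (a p) \<le> K * weight_matrix \<tau>1 l p"
        using \<open>a \<in> Lambda_space \<tau>1 l\<close> by (auto simp: Lambda_space_iff)
      have "E a holomorphic_on sector \<gamma>"
        by (rule holomorphic_transform[OF holomorphic_on_subset[OF f_hol[OF a] sub]]) (simp add: E_def)
      moreover have "A_norm \<tau>2 l1 (sector \<gamma>) (E a) < \<infinity>"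
        using norm_E[OF a] by (auto intro: le_less_trans ennreal_less_top)
      ultimately show ?thesis by (simp add: A_space_def E_def)
    qed
    have borel: "borel_map (sector \<gamma>) (E a) = a" if "a \<in> Lambda_space \<tau>1 l" for a
    proof
      fix N
      obtain K where a: "\<And>p. norm (a p) \<le> K * weight_matrix \<tau>1 l p"
        using \<open>a \<in> Lambda_space \<tau>1 l\<close> by (auto simp: Lambda_space_iff)
      show "borel_map (sector \<gamma>) (E a) N = a N"
      proof (rule borel_map_eqI[OF \<open>0 < \<gamma>\<close>])
        fix w assume w: "w \<in> sector \<gamma>"
        show "norm (surface_higher_deriv N (E a) w - a N)
            \<le> fact N * (2 * (K * c1) * (pi * A (Suc N)) * (2 * B) ^ Suc N * q ^ (Suc N + N)) * exp (Re w)"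
          unfolding E_deriv[OF a w]
          using deriv_bound[OF f_hol[OF a] f_rem[OF a] w, of "Suc N" N] by simp
      qed
    qed
    have lin: "linear_map_on (Lambda_space \<tau>1 l) E"
      unfolding linear_map_on_def
    proof (intro conjI ballI allI ext)
      define t where "t a w p = a p / fact p / m p * exp (of_nat p * w) * \<Psi> p (of_real L - w)"
        for a :: "nat \<Rightarrow> complex" and w p
      have f_t: "f a w = (\<Sum>p. t a w p)" for a w by (simp add: f_def truncated_laplace_def t_def)
      have sum: "summable (t a w)" if mem: "a \<in> Lambda_space \<tau>1 l" "w \<in> sector \<gamma>" for a w
      proof -
        obtain K where a: "\<And>p. norm (a p) \<le> K * weight_matrix \<tau>1 l p"
          using mem by (auto simp: Lambda_space_iff)
        show ?thesis unfolding t_def using f_summable[OF a] mem sub by blast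
      qed
      fix a w assume a: "a \<in> Lambda_space \<tau>1 l"
      show "E (\<lambda>p. c * a p) w = c * E a w" for c
      proof -
        have "t (\<lambda>p. c * a p) w = (\<lambda>p. c * t a w p)" by (simp add: t_def fun_eq_iff)
        then show ?thesis using sum[OF a] by (simp add: E_def f_t suminf_mult)
      qed
      show "E (\<lambda>p. a p + b p) w = E a w + E b w" if b: "b \<in> Lambda_space \<tau>1 l" for b
      proof -
        have "t (\<lambda>p. a p + b p) w = (\<lambda>p. t a w p + t b w p)"
          by (simp add: t_def fun_eq_iff add_divide_distrib algebra_simps)
        then show ?thesis using sum[OF a] sum[OF b] by (simp add: E_def f_t suminf_add)
      qed
    qed
    have "l1 > 0" using \<open>l1 \<ge> 1\<close> by simp
    then show thesis using that[OF _ \<open>Cf \<ge> 0\<close> norm_E E_space borel lin] by blast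
  qed
qed

theorem corollary5p10:
  fixes \<sigma> \<omega> \<tau>\<^sub>1 \<tau>\<^sub>2 :: "real \<Rightarrow> real" and \<gamma> x\<^sub>1 x\<^sub>2 :: real
  assumes "\<sigma> \<in> class_W" and "\<omega> \<in> class_W"
    and "\<omega> \<in> O[at_top](\<sigma>)"
    and "0 < \<gamma>" and "ennreal \<gamma> < growth_index \<sigma> \<omega>"
    and "x\<^sub>1 > 0" and "x\<^sub>2 > 0"
    and "\<tau>\<^sub>1 = omega_seq (hat (weight_matrix \<sigma> x\<^sub>1))"
    and "\<tau>\<^sub>2 = omega_seq (hat (weight_matrix \<omega> x\<^sub>2))"
  shows "(\<forall>l>0. \<exists>l\<^sub>1>0. \<exists>E :: (nat \<Rightarrow> complex) \<Rightarrow> (log_surface \<Rightarrow> complex).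
            E \<in> Lambda_space \<tau>\<^sub>1 l \<rightarrow> A_space \<tau>\<^sub>2 l\<^sub>1 (sector \<gamma>) \<and>
            linear_map_on (Lambda_space \<tau>\<^sub>1 l) E \<and>
            continuous_map_on (Lambda_space \<tau>\<^sub>1 l)
              (Lambda_norm \<tau>\<^sub>1 l) (A_norm \<tau>\<^sub>2 l\<^sub>1 (sector \<gamma>)) E \<and>
            (\<forall>a\<in>Lambda_space \<tau>\<^sub>1 l. borel_map (sector \<gamma>) (E a) = a)) \<and>
         Lambda_union \<tau>\<^sub>1 \<subseteq> borel_map (sector \<gamma>) ` A_union \<tau>\<^sub>2 (sector \<gamma>)"
proof
  obtain r where "gamma_condition \<sigma> \<omega> r" "ennreal \<gamma> < ennreal r"
    using assms(5) by (auto simp: growth_index_def less_SUP_iff)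
  then have r: "\<gamma> < r" "gamma_condition \<sigma> \<omega> r"
    using assms(4) by (auto simp: ennreal_less_iff)
  show main: "\<forall>l>0. \<exists>l\<^sub>1>0. \<exists>E :: (nat \<Rightarrow> complex) \<Rightarrow> (log_surface \<Rightarrow> complex).
            E \<in> Lambda_space \<tau>\<^sub>1 l \<rightarrow> A_space \<tau>\<^sub>2 l\<^sub>1 (sector \<gamma>) \<and>
            linear_map_on (Lambda_space \<tau>\<^sub>1 l) E \<and>
            continuous_map_on (Lambda_space \<tau>\<^sub>1 l)
              (Lambda_norm \<tau>\<^sub>1 l) (A_norm \<tau>\<^sub>2 l\<^sub>1 (sector \<gamma>)) E \<and>
            (\<forall>a\<in>Lambda_space \<tau>\<^sub>1 l. borel_map (sector \<gamma>) (E a) = a)"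
  proof (intro allI impI)
    fix l :: real assume "l > 0"
    show "\<exists>l\<^sub>1>0. \<exists>E :: (nat \<Rightarrow> complex) \<Rightarrow> (log_surface \<Rightarrow> complex).
            E \<in> Lambda_space \<tau>\<^sub>1 l \<rightarrow> A_space \<tau>\<^sub>2 l\<^sub>1 (sector \<gamma>) \<and>
            linear_map_on (Lambda_space \<tau>\<^sub>1 l) E \<and>
            continuous_map_on (Lambda_space \<tau>\<^sub>1 l)
              (Lambda_norm \<tau>\<^sub>1 l) (A_norm \<tau>\<^sub>2 l\<^sub>1 (sector \<gamma>)) E \<and>
            (\<forall>a\<in>Lambda_space \<tau>\<^sub>1 l. borel_map (sector \<gamma>) (E a) = a)"
    proof (rule extension_operator[OF assms(1-4) r assms(6,7) \<open>l > 0\<close> assms(8,9)])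
      fix l1 C :: real and E :: "(nat \<Rightarrow> complex) \<Rightarrow> complex \<Rightarrow> complex"
      assume "l1 > 0" "C \<ge> 0"
      and norm_E: "\<And>a K. (\<And>p. norm (a p) \<le> K * weight_matrix \<tau>\<^sub>1 l p) \<Longrightarrow>
        A_norm \<tau>\<^sub>2 l1 (sector \<gamma>) (E a) \<le> ennreal (K * C)"
      and E: "\<And>a. a \<in> Lambda_space \<tau>\<^sub>1 l \<Longrightarrow> E a \<in> A_space \<tau>\<^sub>2 l1 (sector \<gamma>)"
        "\<And>a. a \<in> Lambda_space \<tau>\<^sub>1 l \<Longrightarrow> borel_map (sector \<gamma>) (E a) = a"
        "linear_map_on (Lambda_space \<tau>\<^sub>1 l) E"
      have "continuous_map_on (Lambda_space \<tau>\<^sub>1 l) (Lambda_norm \<tau>\<^sub>1 l) (A_norm \<tau>\<^sub>2 l1 (sector \<gamma>)) E"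
        unfolding continuous_map_on_def
      proof (intro ballI allI impI)
        fix a and \<epsilon> :: real assume a: "a \<in> Lambda_space \<tau>\<^sub>1 l" and "\<epsilon> > 0"
        define \<delta> where "\<delta> = \<epsilon> / (C + 1)"
        have "\<delta> > 0" "\<delta> * C < \<epsilon>" using \<open>\<epsilon> > 0\<close> \<open>C \<ge> 0\<close> by (auto simp: \<delta>_def field_simps)
        have "A_norm \<tau>\<^sub>2 l1 (sector \<gamma>) (\<lambda>w. E b w - E a w) < ennreal \<epsilon>"
          if b: "b \<in> Lambda_space \<tau>\<^sub>1 l" and ba: "Lambda_norm \<tau>\<^sub>1 l (\<lambda>p. b p - a p) < ennreal \<delta>" for b
        proof -
          have d: "norm (b p - a p) \<le> \<delta> * weight_matrix \<tau>\<^sub>1 l p" for p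
            using Lambda_norm_less_D[OF ba] .
          have "(\<lambda>p. b p - a p) \<in> Lambda_space \<tau>\<^sub>1 l" using d by (auto simp: Lambda_space_iff)
          moreover have "\<forall>a\<in>Lambda_space \<tau>\<^sub>1 l. \<forall>b\<in>Lambda_space \<tau>\<^sub>1 l.
              E (\<lambda>i. a i + b i) = (\<lambda>j. E a j + E b j)"
            using E(3) by (simp add: linear_map_on_def)
          ultimately have "E (\<lambda>p. a p + (b p - a p)) = (\<lambda>w. E a w + E (\<lambda>p. b p - a p) w)"
            using a by (metis (no_types))
          then have "(\<lambda>w. E b w - E a w) = E (\<lambda>p. b p - a p)" by (simp add: fun_eq_iff)
          then have "A_norm \<tau>\<^sub>2 l1 (sector \<gamma>) (\<lambda>w. E b w - E a w) \<le> ennreal (\<delta> * C)"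
            using norm_E[OF d] by simp
          also have "\<dots> < ennreal \<epsilon>" using \<open>\<delta> * C < \<epsilon>\<close> \<open>\<epsilon> > 0\<close> by (simp add: ennreal_lessI)
          finally show ?thesis .
        qed
        then show "\<exists>\<delta>>0. \<forall>b\<in>Lambda_space \<tau>\<^sub>1 l. Lambda_norm \<tau>\<^sub>1 l (\<lambda>p. b p - a p) < ennreal \<delta> \<longrightarrow>
            A_norm \<tau>\<^sub>2 l1 (sector \<gamma>) (\<lambda>w. E b w - E a w) < ennreal \<epsilon>"
          using \<open>\<delta> > 0\<close> by blast
      qed
      with \<open>l1 > 0\<close> E show ?thesis by blast
    qed
  qed
  show "Lambda_union \<tau>\<^sub>1 \<subseteq> borel_map (sector \<gamma>) ` A_union \<tau>\<^sub>2 (sector \<gamma>)"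
  proof
    fix a assume "a \<in> Lambda_union \<tau>\<^sub>1"
    then obtain l where l: "l > 0" "a \<in> Lambda_space \<tau>\<^sub>1 l" by (auto simp: Lambda_union_def)
    then obtain l1 E where "l1 > 0" "E \<in> Lambda_space \<tau>\<^sub>1 l \<rightarrow> A_space \<tau>\<^sub>2 l1 (sector \<gamma>)"
      "borel_map (sector \<gamma>) (E a) = a"
      using main by meson
    with l show "a \<in> borel_map (sector \<gamma>) ` A_union \<tau>\<^sub>2 (sector \<gamma>)"
      unfolding A_union_def by (intro image_eqI[of _ _ "E a"]) auto
  qed
qed

end
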